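(* Let $X$ be a real Banach lattice, let $E\subset X$ be a closed subspace, and let $(e_n)_{n\in\mathbb{N}}$ be a semi-normalized basis of $E$. The following are equivalent: (i) For all $x\in E$, $G_{\pi,m}(x)\xrightarrow{u}x$; (ii) For all $x\in E$, $G_{\pi,m}(x)\xrightarrow{\sigma o}x$; (iii) For all $x\in E$, $G_{\pi,m}(x)\xrightarrow{o}x$; (iv) For all $x\in E$, there exists $u\in X$ such that $G_{\pi,m}^{\vee}(x)\leq u$ for all greedy orderings $\pi$ of $x$ and all $m\in\mathbb{N}$; (v) For all $x\in E$, there exists $C>0$ such that $\|G_m^{\vee\vee}(x)\|\leq C$ for all $m\in\mathbb{N}$; (vi) There exists $C\geq 1$ such that $\|G_m^{\vee\vee}(x)\|\leq C\|x\|$ for all $m\in\mathbb{N}$ and all $x\in E$ with finite support. Here, in (i)–(iii), the collection $\{G_{\pi,m}(x):\pi\in\Gamma(x),\,m\in\mathbb{N}\}$ of all greedy sums of $x$ over all greedy orderings is viewed as a single sequence as described in the context.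
   Context: All Banach spaces are over $\mathbb{R}$; $E$ carries the norm of $X$. "Basis" means Schauder basis; semi-normalized means $0<\inf_n\|e_n\|\le\sup_n\|e_n\|<\infty$; $e_n^*$ denotes the biorthogonal (coefficient) functionals and $\mathrm{supp}(x)=\{n: e_n^*(x)\ne 0\}$. A greedy ordering of $x\in E$ is an injective map $\pi:\mathbb{N}\to\mathbb{N}$ with $\mathrm{supp}(x)\subset\pi(\mathbb{N})$ such that $(|e^*_{\pi(n)}(x)|)_n$ is non-increasing; $\Gamma(x)$ is the set of all greedy orderings of $x$. For $\pi\in\Gamma(x)$ and $m\in\mathbb{N}$ put $$G_{\pi,m}(x)=\sum_{n=1}^m e^*_{\pi(n)}(x)e_{\pi(n)},\qquad G_{\pi,m}^{\vee}(x)=\bigvee_{n=1}^m|G_{\pi,n}(x)|,\qquad G_m^{\vee\vee}(x)=\bigvee_{\pi\in\Gamma(x)}G_{\pi,m}^{\vee}(x).$$ For fixed $x$ and $m$ there are only finitely many distinct $m$-th greedy sums $G_{\pi,m}(x)$, so the last supremum is effectively over a finite set. Sequence convention: using the lexicographic order on pairs $(m,\pi)\in\mathbb{N}\times\Gamma(x)$ ($m$ first), the family of greedy sums is viewed as a sequence: list the finitely many distinct elements of $\{G_{\pi,1}(x):\pi\in\Gamma(x)\}$, then those of $\{G_{\pi,2}(x):\pi\in\Gamma(x)\}$, and so on (the order within each block is immaterial). Convergence in (i)–(iii) is convergence of this sequence. Convergence notions in $X$ for a sequence $(x_j)$: $x_j\xrightarrow{u}x$ if there is $e\in X$ such that for every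 $\epsilon>0$ there is $j_0$ with $|x_j-x|\le\epsilon e$ for all $j\ge j_0$; $x_j\xrightarrow{\sigma o}x$ if there is a decreasing sequence $(u_j)$ with $\inf_j u_j=0$ and $|x_j-x|\le u_j$ for all $j$; $x_j\xrightarrow{o}x$ if there is a decreasing net $(u_\gamma)_{\gamma\in B}$ (arbitrary index set) with $\inf_\gamma u_\gamma=0$ such that for every $\gamma\in B$ there is $j_0$ with $|x_j-x|\le u_\gamma$ for all $j\ge j_0$. *)

theory Defs
  imports
    "HOL-Analysis.Analysis"
    "HOL-Library.Lattice_Algebras"
    "HOL-Library.Lub_Glb"
begin

section \<open>Banach lattices\<close>

text \<open>The class \<open>lattice_ab_group_add_abs\<close> supplies the lattice operations and
  \<open>\<bar>x\<bar> = sup x (- x)\<close>; no order completeness is assumed.\<close>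

class banach_lattice = banach + ordered_real_vector + lattice_ab_group_add_abs +
  assumes norm_lattice_mono: "\<bar>x\<bar> \<le> \<bar>y\<bar> \<Longrightarrow> norm x \<le> norm y"

instance real :: banach_lattice
  by standard (auto simp: abs_if sup_max max_def)


section \<open>Convergence in a Banach lattice\<close>

definition uniform_conv :: "(nat \<Rightarrow> 'a::banach_lattice) \<Rightarrow> 'a \<Rightarrow> bool" where
  "uniform_conv s x \<longleftrightarrow>
     (\<exists>e. \<forall>\<epsilon>>0. \<exists>j0. \<forall>j\<ge>j0. \<bar>s j - x\<bar> \<le> \<epsilon> *\<^sub>R e)"

definition sigma_order_conv :: "(nat \<Rightarrow> 'a::banach_lattice) \<Rightarrow> 'a \<Rightarrow> bool" where
  "sigma_order_conv s x \<longleftrightarrow>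
     (\<exists>u. decseq u \<and> isGlb UNIV (range u) 0 \<and> (\<forall>j. \<bar>s j - x\<bar> \<le> u j))"

definition directed_preorder :: "'i set \<Rightarrow> ('i \<Rightarrow> 'i \<Rightarrow> bool) \<Rightarrow> bool" where
  "directed_preorder B le \<longleftrightarrow> B \<noteq> {} \<and> (\<forall>a\<in>B. le a a) \<and>
     (\<forall>a\<in>B. \<forall>b\<in>B. \<forall>c\<in>B. le a b \<longrightarrow> le b c \<longrightarrow> le a c) \<and>
     (\<forall>a\<in>B. \<forall>b\<in>B. \<exists>c\<in>B. le a c \<and> le b c)"

definition order_dominated_by ::
    "(nat \<Rightarrow> 'a::banach_lattice) \<Rightarrow> 'a \<Rightarrow> 'i set \<Rightarrow> ('i \<Rightarrow> 'i \<Rightarrow> bool) \<Rightarrow> ('i \<Rightarrow> 'a) \<Rightarrow> bool" where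
  "order_dominated_by s x B le u \<longleftrightarrow>
     directed_preorder B le \<and>
     (\<forall>a\<in>B. \<forall>b\<in>B. le a b \<longrightarrow> u b \<le> u a) \<and>
     isGlb UNIV (u ` B) 0 \<and>
     (\<forall>\<gamma>\<in>B. \<exists>j0. \<forall>j\<ge>j0. \<bar>s j - x\<bar> \<le> u \<gamma>)"

text \<open>HOL cannot quantify over index types inside a formula, so the dominating net is indexed by a
  directed subset of the space itself.  By \<open>order_convI\<close> this loses nothing: a dominating net over
  an arbitrary index type already gives convergence in this sense.\<close>

definition order_conv :: "(nat \<Rightarrow> 'a::banach_lattice) \<Rightarrow> 'a \<Rightarrow> bool" where
  "order_conv s x \<longleftrightarrow>
     (\<exists>(B :: 'a set) (le :: 'a \<Rightarrow> 'a \<Rightarrow> bool) (u :: 'a \<Rightarrow> 'a). order_dominated_by s x B le u)"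

lemma order_convI:
  fixes B :: "'i set"
  assumes "order_dominated_by s x B le u"
  shows "order_conv s x"
proof -
  have dir: "directed_preorder B le" and dec: "\<And>i j. i \<in> B \<Longrightarrow> j \<in> B \<Longrightarrow> le i j \<Longrightarrow> u j \<le> u i"
    and glb: "isGlb UNIV (u ` B) 0" and dom: "\<forall>\<gamma>\<in>B. \<exists>j0. \<forall>j\<ge>j0. \<bar>s j - x\<bar> \<le> u \<gamma>"
    using assms unfolding order_dominated_by_def by blast+
  have "\<exists>c\<in>u ` B. c \<le> a \<and> c \<le> b" if "a \<in> u ` B" "b \<in> u ` B" for a b
  proof -
    from that obtain i j where ij: "i \<in> B" "j \<in> B" "a = u i" "b = u j" by blast
    with dir obtain k where "k \<in> B" "le i k" "le j k"
      unfolding directed_preorder_def by metis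
    with ij dec show ?thesis by blast
  qed
  moreover have "u ` B \<noteq> {}"
    using dir unfolding directed_preorder_def by blast
  ultimately have "directed_preorder (u ` B) (\<lambda>a b. b \<le> a)"
    unfolding directed_preorder_def by (meson order.refl order.trans)
  then have "order_dominated_by s x (u ` B) (\<lambda>a b. b \<le> a) (\<lambda>a. a)"
    using glb dom unfolding order_dominated_by_def by (simp add: image_ident)
  then show ?thesis unfolding order_conv_def by blast
qed


section \<open>Bases and greedy sums\<close>

definition schauder_basis :: "(nat \<Rightarrow> 'a::real_normed_vector) \<Rightarrow> 'a set \<Rightarrow> bool" where
  "schauder_basis e E \<longleftrightarrow>
     (\<forall>n. e n \<in> E) \<and> (\<forall>x\<in>E. \<exists>!a :: nat \<Rightarrow> real. (\<lambda>n. a n *\<^sub>R e n) sums x)"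

definition semi_normalized :: "(nat \<Rightarrow> 'a::real_normed_vector) \<Rightarrow> bool" where
  "semi_normalized e \<longleftrightarrow> 0 < (INF n. norm (e n)) \<and> bdd_above (range (\<lambda>n. norm (e n)))"

text \<open>\<open>coeff_fun e n\<close> is the coefficient functional \<open>e\<^sub>n\<^sup>*\<close>; it is only meaningful on a space
  with basis \<open>e\<close>.\<close>

definition coeff_fun :: "(nat \<Rightarrow> 'a::real_normed_vector) \<Rightarrow> nat \<Rightarrow> 'a \<Rightarrow> real" where
  "coeff_fun e n x = (THE a. (\<lambda>n. a n *\<^sub>R e n) sums x) n"

definition basis_supp :: "(nat \<Rightarrow> 'a::real_normed_vector) \<Rightarrow> 'a \<Rightarrow> nat set" where
  "basis_supp e x = {n. coeff_fun e n x \<noteq> 0}"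

definition greedy_orderings :: "(nat \<Rightarrow> 'a::real_normed_vector) \<Rightarrow> 'a \<Rightarrow> (nat \<Rightarrow> nat) set" where
  "greedy_orderings e x =
     {\<pi>. inj \<pi> \<and> basis_supp e x \<subseteq> range \<pi> \<and> decseq (\<lambda>n. \<bar>coeff_fun e (\<pi> n) x\<bar>)}"

text \<open>Indices start at 0, so the \<open>m\<close>-th greedy sum runs over \<open>n < m\<close>; the number of terms \<open>m\<close>
  itself starts at 1, as do the suprema below.\<close>

definition greedy_sum :: "(nat \<Rightarrow> 'a::real_normed_vector) \<Rightarrow> (nat \<Rightarrow> nat) \<Rightarrow> nat \<Rightarrow> 'a \<Rightarrow> 'a" where
  "greedy_sum e \<pi> m x = (\<Sum>n<m. coeff_fun e (\<pi> n) x *\<^sub>R e (\<pi> n))"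

text \<open>The set in \<open>greedy_max_all\<close> is finite, when \<open>e\<close> is a semi-normalized basis, by
  \<open>finite_greedy_max_set\<close>, and \<open>Sup_fin\<close> is then its supremum.\<close>

definition greedy_max :: "(nat \<Rightarrow> 'a::banach_lattice) \<Rightarrow> (nat \<Rightarrow> nat) \<Rightarrow> nat \<Rightarrow> 'a \<Rightarrow> 'a" where
  "greedy_max e \<pi> m x = Sup_fin ((\<lambda>n. \<bar>greedy_sum e \<pi> n x\<bar>) ` {1..m})"

definition greedy_max_all :: "(nat \<Rightarrow> 'a::banach_lattice) \<Rightarrow> nat \<Rightarrow> 'a \<Rightarrow> 'a" where
  "greedy_max_all e m x = Sup_fin ((\<lambda>\<pi>. greedy_max e \<pi> m x) ` greedy_orderings e x)"

definition greedy_sums :: "(nat \<Rightarrow> 'a::real_normed_vector) \<Rightarrow> nat \<Rightarrow> 'a \<Rightarrow> 'a set" where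
  "greedy_sums e m x = (\<lambda>\<pi>. greedy_sum e \<pi> m x) ` greedy_orderings e x"

definition greedy_block :: "(nat \<Rightarrow> 'a::real_normed_vector) \<Rightarrow> nat \<Rightarrow> 'a \<Rightarrow> 'a list" where
  "greedy_block e m x = (SOME l. distinct l \<and> set l = greedy_sums e m x)"

text \<open>All greedy sums of \<open>x\<close>, block after block.  Blocks are nonempty, so the first \<open>j + 1\<close> of
  them contain the entry at position \<open>j\<close>.\<close>

definition greedy_seq :: "(nat \<Rightarrow> 'a::real_normed_vector) \<Rightarrow> 'a \<Rightarrow> nat \<Rightarrow> 'a" where
  "greedy_seq e x j = concat (map (\<lambda>m. greedy_block e m x) [1..<j + 2]) ! j"


section \<open>The suprema and the sequence of greedy sums are well defined\<close>

lemma coeff_fun_sums: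
  assumes "schauder_basis e E" "x \<in> E"
  shows "(\<lambda>n. coeff_fun e n x *\<^sub>R e n) sums x"
  using theI'[of "\<lambda>a. (\<lambda>n. a n *\<^sub>R e n) sums x"] assms
  unfolding schauder_basis_def coeff_fun_def by blast

lemma finite_large_coeff:
  assumes "schauder_basis e E" "semi_normalized e" "x \<in> E" "0 < t"
  shows "finite {n. t \<le> \<bar>coeff_fun e n x\<bar>}"
proof -
  define c where "c = (INF n. norm (e n))"
  have c: "0 < c" using assms unfolding semi_normalized_def c_def by blast
  have ce: "c \<le> norm (e n)" for n
    unfolding c_def by (rule cINF_lower) (auto intro!: bdd_belowI[of _ 0])
  have "(\<lambda>n. coeff_fun e n x *\<^sub>R e n) \<longlonglongrightarrow> 0"
    using coeff_fun_sums[OF assms(1,3)] sums_summable summable_LIMSEQ_zero by blast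
  then have "\<forall>\<^sub>F n in sequentially. norm (coeff_fun e n x *\<^sub>R e n) < t * c"
    using c assms(4) by (auto simp: tendsto_iff dist_norm)
  then obtain N where N: "norm (coeff_fun e n x *\<^sub>R e n) < t * c" if "n \<ge> N" for n
    unfolding eventually_sequentially by blast
  have "{n. t \<le> \<bar>coeff_fun e n x\<bar>} \<subseteq> {..<N}"
  proof
    fix n assume "n \<in> {n. t \<le> \<bar>coeff_fun e n x\<bar>}"
    then have "t * c \<le> norm (coeff_fun e n x *\<^sub>R e n)"
      using ce[of n] c assms(4) by (auto intro!: mult_mono)
    then show "n \<in> {..<N}" using N[of n] by force
  qed
  then show ?thesis using finite_subset by blast
qed

lemma greedy_orderings_nonempty:
  assumes "schauder_basis e E" "semi_normalized e" "x \<in> E"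
  shows "greedy_orderings e x \<noteq> {}"
proof -
  define a where "a = (\<lambda>n. \<bar>coeff_fun e n x\<bar>)"
  have fin: "finite {n. t \<le> a n}" if "0 < t" for t
    using finite_large_coeff[OF assms that] by (simp add: a_def)
  define sel where "sel = (\<lambda>T. SOME k. k \<notin> T \<and> (\<forall>j. j \<notin> T \<longrightarrow> a j \<le> a k))"
  have sel: "sel T \<notin> T \<and> (\<forall>j. j \<notin> T \<longrightarrow> a j \<le> a (sel T))" if T: "finite T" for T
  proof -
    have "\<exists>k. k \<notin> T \<and> (\<forall>j. j \<notin> T \<longrightarrow> a j \<le> a k)"
    proof (cases "\<exists>i. i \<notin> T \<and> 0 < a i")
      case True
      then obtain i where i: "i \<notin> T" "0 < a i" by blast
      define F where "F = {n. a i \<le> a n} - T"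
      have F: "finite F" "i \<in> F" using fin[OF i(2)] i by (auto simp: F_def)
      then have "Max (a ` F) \<in> a ` F" by (intro Max_in) auto
      then obtain k where k: "k \<in> F" "a k = Max (a ` F)" by auto
      have "a j \<le> a k" if "j \<notin> T" for j
      proof (cases "j \<in> F")
        case False
        then have "a j < a i" using that by (auto simp: F_def)
        also have "a i \<le> a k" using k by (auto simp: F_def)
        finally show ?thesis by simp
      qed (use k F in simp)
      then show ?thesis using k by (auto simp: F_def)
    next
      case False
      then have "a j \<le> a k" if "j \<notin> T" for j k
        using that by (smt (verit) a_def abs_ge_zero)
      moreover have "\<exists>k. k \<notin> T" using T ex_new_if_finite infinite_UNIV_nat by blast
      ultimately show ?thesis by blast
    qed
    then show ?thesis unfolding sel_def by (rule someI_ex)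
  qed
  define T where "T = rec_nat {} (\<lambda>_ S. insert (sel S) S)"
  have T0: "T 0 = {}" and TS: "T (Suc n) = insert (sel (T n)) (T n)" for n
    by (simp_all add: T_def)
  define p where "p = (\<lambda>n. sel (T n))"
  have T: "T n = p ` {..<n}" for n
    by (induction n) (auto simp: T0 TS p_def lessThan_Suc)
  have p: "p n \<notin> p ` {..<n}" "\<And>j. j \<notin> p ` {..<n} \<Longrightarrow> a j \<le> a (p n)" for n
  proof -
    have "p n = sel (p ` {..<n})" by (metis p_def T)
    moreover have "finite (p ` {..<n})" by simp
    ultimately show "p n \<notin> p ` {..<n}" "\<And>j. j \<notin> p ` {..<n} \<Longrightarrow> a j \<le> a (p n)"
      using sel by metis+
  qed
  have inj: "inj p"
    by (rule linorder_injI) (metis p(1) imageI lessThan_iff)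
  have dec: "decseq (\<lambda>n. a (p n))"
    unfolding decseq_Suc_iff
  proof
    fix n
    have "p (Suc n) \<notin> p ` {..<n}" using p(1)[of "Suc n"] by auto
    then show "a (p (Suc n)) \<le> a (p n)" by (rule p(2))
  qed
  have "basis_supp e x \<subseteq> range p"
  proof (rule ccontr)
    assume "\<not> ?thesis"
    then obtain k where k: "0 < a k" "k \<notin> range p" by (auto simp: basis_supp_def a_def)
    then have "range p \<subseteq> {n. a k \<le> a n}" using p(2)[of k] by blast
    then show False using fin[OF k(1)] inj finite_subset range_inj_infinite by blast
  qed
  then show ?thesis using inj dec unfolding greedy_orderings_def a_def by blast
qed

lemma finite_greedy_sums:
  assumes "schauder_basis e E" "semi_normalized e" "x \<in> E"
  shows "finite (greedy_sums e m x)"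
proof -
  define a where "a = (\<lambda>n. \<bar>coeff_fun e n x\<bar>)"
  define A where "A = basis_supp e x"
  define g where "g = (\<lambda>D. \<Sum>n\<in>D. coeff_fun e n x *\<^sub>R e n)"
  have g: "greedy_sum e \<pi> m x = g (\<pi> ` {..<m} \<inter> A)" if "\<pi> \<in> greedy_orderings e x" for \<pi>
  proof -
    have "inj_on \<pi> {..<m}"
      using that by (auto simp: greedy_orderings_def intro: inj_on_subset)
    then have "greedy_sum e \<pi> m x = g (\<pi> ` {..<m})"
      by (simp add: greedy_sum_def g_def sum.reindex)
    also have "\<dots> = g (\<pi> ` {..<m} \<inter> A)"
      unfolding g_def A_def basis_supp_def by (rule sum.mono_neutral_right) auto
    finally show ?thesis .
  qed
  have "\<exists>K. finite K \<and> (\<forall>\<pi>\<in>greedy_orderings e x. \<pi> ` {..<m} \<inter> A \<subseteq> K)"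
  proof (cases "finite A")
    case False
    then obtain S where S: "S \<subseteq> A" "finite S" "card S = Suc m"
      using infinite_arbitrarily_large by blast
    define t where "t = Min (a ` S)"
    have "S \<noteq> {}" using S by auto
    then have t: "0 < t" "\<And>k. k \<in> S \<Longrightarrow> t \<le> a k"
      using S by (auto simp: t_def A_def basis_supp_def a_def)
    have "\<pi> ` {..<m} \<subseteq> {n. t \<le> a n}" if \<pi>: "\<pi> \<in> greedy_orderings e x" for \<pi>
    proof (rule ccontr)
      assume "\<not> ?thesis"
      then obtain n where n: "n < m" "a (\<pi> n) < t" unfolding subset_eq by (auto simp: not_le)
      have "S \<subseteq> \<pi> ` {..<n}"
      proof
        fix k assume k: "k \<in> S"
        then obtain i where i: "k = \<pi> i" using \<pi> S by (auto simp: greedy_orderings_def A_def)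
        have "\<not> n \<le> i"
        proof
          assume "n \<le> i"
          then have "a (\<pi> i) \<le> a (\<pi> n)"
            using \<pi> unfolding greedy_orderings_def a_def decseq_def by blast
          then show False using t(2)[OF k] n i by simp
        qed
        then show "k \<in> \<pi> ` {..<n}" using i by auto
      qed
      then have "card S \<le> card (\<pi> ` {..<n})" by (intro card_mono) auto
      also have "\<dots> \<le> n" using card_image_le[of "{..<n}" \<pi>] by simp
      finally show False using S n by simp
    qed
    then show ?thesis
      using finite_large_coeff[OF assms t(1)] unfolding a_def by blast
  qed blast
  then obtain K where "finite K" "\<forall>\<pi>\<in>greedy_orderings e x. \<pi> ` {..<m} \<inter> A \<subseteq> K"
    by blast
  then have "greedy_sums e m x \<subseteq> g ` Pow K" "finite (g ` Pow K)"
    using g by (auto simp: greedy_sums_def)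
  then show ?thesis using finite_subset by blast
qed

lemma finite_greedy_max_set:
  assumes "schauder_basis e E" "semi_normalized e" "x \<in> E"
  shows "finite ((\<lambda>\<pi>. greedy_max e \<pi> m x) ` greedy_orderings e x)"
proof -
  have "greedy_max e \<pi> m x \<in> Sup_fin ` Pow (abs ` (\<Union>n\<in>{1..m}. greedy_sums e n x))"
    if "\<pi> \<in> greedy_orderings e x" for \<pi>
    unfolding greedy_max_def greedy_sums_def using that by (intro imageI) auto
  then have "(\<lambda>\<pi>. greedy_max e \<pi> m x) ` greedy_orderings e x
      \<subseteq> Sup_fin ` Pow (abs ` (\<Union>n\<in>{1..m}. greedy_sums e n x))" by blast
  then show ?thesis
    by (rule finite_subset) (simp add: finite_greedy_sums[OF assms])
qed

lemma greedy_block: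
  assumes "schauder_basis e E" "semi_normalized e" "x \<in> E"
  shows "distinct (greedy_block e m x)" "set (greedy_block e m x) = greedy_sums e m x"
    "greedy_block e m x \<noteq> []"
proof -
  have "\<exists>l. distinct l \<and> set l = greedy_sums e m x"
    using finite_distinct_list[OF finite_greedy_sums[OF assms]] by blast
  from someI_ex[OF this]
  show "distinct (greedy_block e m x)" "set (greedy_block e m x) = greedy_sums e m x"
    unfolding greedy_block_def by auto
  then show "greedy_block e m x \<noteq> []"
    using greedy_orderings_nonempty[OF assms] by (auto simp: greedy_sums_def)
qed


definition all_equivalent :: "bool list \<Rightarrow> bool" where
  "all_equivalent Ps \<longleftrightarrow> (\<forall>P\<in>set Ps. \<forall>Q\<in>set Ps. P \<longleftrightarrow> Q)"

end

theory Submission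
  imports Defs
begin

text \<open>(v) implies (vi) is a gliding hump.  If the maximal inequality fails, it fails on every tail
  of the basis, because the coefficient functionals are uniformly bounded (Baire).  One can then stack
  disjointly supported blocks of norm at most \<open>2\<^sup>-\<^sup>k\<close> whose coefficients lie below those of the
  earlier blocks, but whose maximal functions grow without bound; each greedy sum of a block is a
  greedy sum of the total minus the earlier blocks.

  (vi) implies (i): first, the projections of \<open>x\<close> onto the level sets
  \<open>{n. t \<le> \<bar>e\<^sub>n\<^sup>*(x)\<bar>}\<close> converge to \<open>x\<close> in norm as \<open>t \<rightarrow> 0\<close>.  Along thresholds for which the
  error is at most \<open>4\<^sup>-\<^sup>k\<close>, all greedy sums between two consecutive levels stay within the
  distance \<open>w\<^sub>k\<close> of \<open>x\<close>, where \<open>w\<^sub>k\<close> involves the maximal function of the difference of the two level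
  projections and has norm \<open>O(4\<^sup>-\<^sup>k)\<close>; the vector \<open>\<Sum>\<^sub>k 2\<^sup>k w\<^sub>k\<close> regulates the convergence.\<close>

section \<open>Banach lattices\<close>

lemma abs_add_le_add:
  fixes x y :: "'a::ordered_ab_group_add_abs"
  assumes "\<bar>x\<bar> \<le> u" "\<bar>y\<bar> \<le> v"
  shows "\<bar>x + y\<bar> \<le> u + v"
  using order_trans[OF abs_triangle_ineq add_mono[OF assms]] .

lemma norm_le_if_abs_le:
  fixes x y :: "'a::banach_lattice"
  assumes "\<bar>x\<bar> \<le> y"
  shows "norm x \<le> norm y"
proof -
  have "0 \<le> y" using assms abs_ge_zero order_trans by blast
  then show ?thesis using assms by (intro norm_lattice_mono) simp
qed

lemma norm_abs_lattice: "norm \<bar>x\<bar> = norm x" for x :: "'a::banach_lattice"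
  by (intro antisym norm_lattice_mono) simp_all

lemma abs_scaleR_lattice:
  fixes x :: "'a::banach_lattice"
  assumes "0 \<le> c"
  shows "\<bar>c *\<^sub>R x\<bar> = c *\<^sub>R \<bar>x\<bar>"
proof -
  have le: "\<bar>c *\<^sub>R x\<bar> \<le> c *\<^sub>R \<bar>x\<bar>" if "0 \<le> c" for c and x :: 'a
  proof (rule abs_leI)
    show "c *\<^sub>R x \<le> c *\<^sub>R \<bar>x\<bar>" using that by (intro scaleR_left_mono) (simp_all add: abs_ge_self)
    have "c *\<^sub>R (- x) \<le> c *\<^sub>R \<bar>x\<bar>"
      using that by (intro scaleR_left_mono) (simp_all add: abs_ge_minus_self)
    then show "- (c *\<^sub>R x) \<le> c *\<^sub>R \<bar>x\<bar>" by simp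
  qed
  show ?thesis
  proof (cases "c = 0")
    case False
    then have c: "0 < c" using assms by simp
    \<comment> \<open>The reverse inequality is the first one again, for the factor
      \<open>inverse c\<close> and the vector \<open>c *\<^sub>R x\<close>.\<close>
    have "\<bar>x\<bar> \<le> inverse c *\<^sub>R \<bar>c *\<^sub>R x\<bar>"
      using le[of "inverse c" "c *\<^sub>R x"] c by simp
    then have "c *\<^sub>R \<bar>x\<bar> \<le> c *\<^sub>R (inverse c *\<^sub>R \<bar>c *\<^sub>R x\<bar>)"
      using c by (intro scaleR_left_mono) simp_all
    then show ?thesis using c le[OF assms, of x] by (intro antisym) simp_all
  qed simp
qed

text \<open>If \<open>w\<close> lies above \<open>x\<close>, the positive part of \<open>x\<close>
  lies below the modulus of \<open>w\<close>, so arbitrarily small \<open>w\<close> force it to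
  vanish. This is the closedness of the positive cone in the form used below.\<close>

lemma nonpos_if_small_upper_bounds:
  fixes x :: "'a::banach_lattice"
  assumes "\<And>\<delta>. 0 < \<delta> \<Longrightarrow> \<exists>w. x \<le> w \<and> norm w \<le> \<delta>"
  shows "x \<le> 0"
proof -
  have "norm (pprt x) \<le> 0 + \<delta>" if \<delta>: "0 < \<delta>" for \<delta>
  proof -
    obtain w where w: "x \<le> w" "norm w \<le> \<delta>" using assms[OF \<delta>] by blast
    have "x \<le> \<bar>w\<bar>" using w(1) abs_ge_self order_trans by blast
    then have "\<bar>pprt x\<bar> \<le> \<bar>w\<bar>"
      by (simp only: abs_of_nonneg[OF zero_le_pprt]) (simp add: pprt_def)
    then show ?thesis using norm_lattice_mono[of "pprt x" w] w(2) by simp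
  qed
  then have "norm (pprt x) \<le> 0" by (rule field_le_epsilon)
  then show ?thesis by (simp add: le_zero_iff_zero_pprt)
qed

lemma lattice_LIMSEQ_le_const:
  fixes X :: "nat \<Rightarrow> 'a::banach_lattice"
  assumes "X \<longlonglongrightarrow> l" "\<forall>\<^sub>F n in sequentially. y \<le> X n"
  shows "y \<le> l"
proof -
  have "y - l \<le> 0"
  proof (rule nonpos_if_small_upper_bounds)
    fix \<delta> :: real assume "0 < \<delta>"
    then have "\<forall>\<^sub>F n in sequentially. norm (X n - l) < \<delta>"
      using assms(1) by (auto simp: tendsto_iff dist_norm)
    then have "\<forall>\<^sub>F n in sequentially. norm (X n - l) < \<delta> \<and> y \<le> X n"
      using assms(2) by eventually_elim simp
    then obtain n where "norm (X n - l) < \<delta>" "y \<le> X n"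
      using eventually_happens trivial_limit_sequentially by blast
    then show "\<exists>w. y - l \<le> w \<and> norm w \<le> \<delta>" by (intro exI[of _ "X n - l"]) auto
  qed
  then show ?thesis by simp
qed

lemma le_suminf_lattice:
  fixes f :: "nat \<Rightarrow> 'a::banach_lattice"
  assumes "summable f" "\<And>n. 0 \<le> f n"
  shows "f n \<le> suminf f"
proof (rule lattice_LIMSEQ_le_const)
  show "(\<lambda>n. \<Sum>i<n. f i) \<longlonglongrightarrow> suminf f" using assms(1) by (rule summable_LIMSEQ)
  have "f n \<le> (\<Sum>i<m. f i)" if "Suc n \<le> m" for m
    using that assms(2) sum_mono2[of "{..<m}" "{n}" f] by simp
  then show "\<forall>\<^sub>F m in sequentially. f n \<le> (\<Sum>i<m. f i)"
    using eventually_sequentially by blast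
qed

section \<open>Comparison of the modes of convergence\<close>

text \<open>The dominating sequence consists of multiples of one vector above all errors; the
  factors are the best constants for the tails, slightly enlarged.\<close>

lemma uniform_conv_imp_sigma_order_conv:
  assumes "uniform_conv s x"
  shows "sigma_order_conv s x"
proof -
  obtain e where e: "\<And>\<epsilon>. 0 < \<epsilon> \<Longrightarrow> \<exists>j0. \<forall>j\<ge>j0. \<bar>s j - x\<bar> \<le> \<epsilon> *\<^sub>R e"
    using assms unfolding uniform_conv_def by blast
  obtain N where N: "\<And>j. j \<ge> N \<Longrightarrow> \<bar>s j - x\<bar> \<le> e" using e[of 1] by auto
  have e0: "0 \<le> e" using N[of N] abs_ge_zero order_trans by blast
  \<comment> \<open>Domination is required from index 0 on, so the finitely many errors before
    \<open>N\<close> are added to the regulator.\<close>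
  define W where "W = e + (\<Sum>i<N. \<bar>s i - x\<bar>)"
  have eW: "e \<le> W" by (simp add: W_def sum_nonneg)
  have W0: "0 \<le> W" using e0 eW by simp
  have bd: "\<bar>s j - x\<bar> \<le> W" for j
  proof (cases "j < N")
    case True
    then have "\<bar>s j - x\<bar> \<le> (\<Sum>i<N. \<bar>s i - x\<bar>)"
      using sum_mono2[of "{..<N}" "{j}" "\<lambda>i. \<bar>s i - x\<bar>"] by simp
    then show ?thesis using e0 by (simp add: W_def add_increasing)
  next
    case False
    then show ?thesis using N[of j] eW by (meson not_less order_trans)
  qed
  define R where "R j = {r. 0 \<le> r \<and> (\<forall>i\<ge>j. \<bar>s i - x\<bar> \<le> r *\<^sub>R W)}" for j
  have R1: "1 \<in> R j" for j using bd by (simp add: R_def)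
  have Rbdd: "bdd_below (R j)" for j by (rule bdd_belowI[of _ 0]) (simp add: R_def)
  \<comment> \<open>The added null sequence puts \<open>d j\<close> strictly above the infimum, so
    some admissible constant lies below \<open>d j\<close> whether or not the infimum is
    attained.\<close>
  define d where "d j = Inf (R j) + inverse (real (Suc j))" for j
  define u where "u j = d j *\<^sub>R W" for j
  have d0: "0 \<le> d j" for j
  proof -
    have "0 \<le> Inf (R j)" using R1[of j] by (intro cInf_greatest) (blast, simp add: R_def)
    then show ?thesis by (simp add: d_def)
  qed
  have "decseq d"
    unfolding decseq_def d_def
  proof (intro allI impI add_mono)
    fix m n :: nat assume mn: "m \<le> n"
    have "R m \<subseteq> R n" using mn by (auto simp: R_def)
    then show "Inf (R n) \<le> Inf (R m)" using R1 Rbdd by (intro cInf_superset_mono) auto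
    show "inverse (real (Suc n)) \<le> inverse (real (Suc m))" using mn by simp
  qed
  then have "decseq u"
    using W0 by (auto simp: decseq_def u_def intro!: scaleR_right_mono)
  moreover have "\<bar>s j - x\<bar> \<le> u j" for j
  proof -
    have "\<exists>r\<in>R j. r < d j"
      using R1[of j] Rbdd[of j] by (intro cInf_lessD) (auto simp: d_def)
    then obtain r where r: "\<bar>s j - x\<bar> \<le> r *\<^sub>R W" "r < d j" by (auto simp: R_def)
    then show ?thesis using scaleR_right_mono[of r "d j" W] W0 unfolding u_def by simp
  qed
  moreover have "isGlb UNIV (range u) 0"
  proof -
    have "y \<le> 0" if y: "\<And>j. y \<le> u j" for y
    proof (rule nonpos_if_small_upper_bounds)
      fix \<delta> :: real assume \<delta>: "0 < \<delta>"
      \<comment> \<open>Adding 1 keeps the divisor positive when \<open>W\<close> is 0.\<close>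
      define M where "M = norm W + 1"
      define \<epsilon> where "\<epsilon> = \<delta> / (2 * M)"
      have nz: "0 < M" using norm_ge_zero[of W] unfolding M_def by linarith
      have \<epsilon>: "0 < \<epsilon>" using \<delta> nz by (simp add: \<epsilon>_def)
      obtain j0 where j0: "\<And>j. j \<ge> j0 \<Longrightarrow> \<bar>s j - x\<bar> \<le> \<epsilon> *\<^sub>R e" using e[OF \<epsilon>] by blast
      obtain j1 where j1: "inverse (real (Suc j1)) < \<epsilon>" using \<epsilon> reals_Archimedean by blast
      define j where "j = max j0 j1"
      have "\<epsilon> \<in> R j"
      proof -
        have "\<bar>s i - x\<bar> \<le> \<epsilon> *\<^sub>R W" if "j \<le> i" for i
          using that j0[of i] scaleR_left_mono[OF eW, of \<epsilon>] \<epsilon> by (auto simp: j_def)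
        then show ?thesis using \<epsilon> by (simp add: R_def)
      qed
      then have "Inf (R j) \<le> \<epsilon>" using Rbdd by (rule cInf_lower)
      moreover have "inverse (real (Suc j)) \<le> inverse (real (Suc j1))" by (simp add: j_def)
      ultimately have "d j \<le> 2 * \<epsilon>" using j1 unfolding d_def by linarith
      then have "norm (u j) \<le> 2 * \<epsilon> * norm W"
        using d0[of j] by (simp add: u_def mult_right_mono)
      also have "\<dots> \<le> 2 * \<epsilon> * M" using \<epsilon> by (simp add: M_def)
      also have "\<dots> = \<delta>" using nz by (simp add: \<epsilon>_def)
      finally show "\<exists>w. y \<le> w \<and> norm w \<le> \<delta>" using y by blast
    qed
    moreover have "0 \<le> u j" for j using d0 W0 by (simp add: u_def scaleR_nonneg_nonneg)
    ultimately show ?thesis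
      unfolding isGlb_def greatestP_def isLb_def setge_def setle_def by auto
  qed
  ultimately show ?thesis unfolding sigma_order_conv_def by blast
qed

text \<open>A decreasing sequence is a net indexed by the naturals; \<open>order_convI\<close> moves
  it to an index set inside the space.\<close>

lemma sigma_order_conv_imp_order_conv:
  assumes "sigma_order_conv s x"
  shows "order_conv s x"
proof -
  obtain u where u: "decseq u" "isGlb UNIV (range u) 0" "\<And>j. \<bar>s j - x\<bar> \<le> u j"
    using assms unfolding sigma_order_conv_def by blast
  have "\<forall>j\<ge>n. \<bar>s j - x\<bar> \<le> u n" for n using u(1,3) order_trans unfolding decseq_def by blast
  then have "order_dominated_by s x UNIV (\<le>) u"
    using u(1,2) unfolding order_dominated_by_def directed_preorder_def decseq_def
    by (auto intro: max.cobounded1 max.cobounded2)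
  then show ?thesis by (rule order_convI)
qed

text \<open>One member of the dominating net bounds a tail of the errors; the finitely many
  remaining terms lie below the sum of their moduli.\<close>

lemma order_conv_imp_bounded:
  assumes "order_conv s x"
  shows "\<exists>u. \<forall>j. \<bar>s j\<bar> \<le> u"
proof -
  obtain w N where wN: "\<And>j. j \<ge> N \<Longrightarrow> \<bar>s j - x\<bar> \<le> w"
    using assms unfolding order_conv_def order_dominated_by_def directed_preorder_def by blast
  have w0: "0 \<le> w" using wN[of N] abs_ge_zero order_trans by blast
  have "\<bar>s j\<bar> \<le> w + \<bar>x\<bar> + (\<Sum>i<N. \<bar>s i\<bar>)" for j
  proof (cases "j < N")
    case True
    then have "\<bar>s j\<bar> \<le> (\<Sum>i<N. \<bar>s i\<bar>)"
      using sum_mono2[of "{..<N}" "{j}" "\<lambda>i. \<bar>s i\<bar>"] by simp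
    then show ?thesis using w0 by (simp add: add_increasing)
  next
    case False
    have "\<bar>s j\<bar> \<le> \<bar>s j - x\<bar> + \<bar>x\<bar>" using abs_triangle_ineq[of "s j - x" x] by simp
    also have "\<dots> \<le> w + \<bar>x\<bar>" using False wN by simp
    also have "\<dots> \<le> w + \<bar>x\<bar> + (\<Sum>i<N. \<bar>s i\<bar>)" by (simp add: sum_nonneg)
    finally show ?thesis .
  qed
  then show ?thesis by blast
qed

section \<open>Schauder bases\<close>

text \<open>For infinite \<open>A\<close> the sum defaults to 0, so this is the coordinate
  projection for finite \<open>A\<close> only.\<close>

definition basis_proj :: "(nat \<Rightarrow> 'a::real_normed_vector) \<Rightarrow> nat set \<Rightarrow> 'a \<Rightarrow> 'a" where
  "basis_proj e A x = (\<Sum>n\<in>A. coeff_fun e n x *\<^sub>R e n)"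

locale schauder_basic_sequence =
  fixes e :: "nat \<Rightarrow> 'a::banach" and E :: "'a set"
  assumes subspace_E: "subspace E" and closed_E: "closed E" and basis: "schauder_basis e E"
begin

lemma e_in_E [simp]: "e n \<in> E"
  using basis by (simp add: schauder_basis_def)

lemma coeff_sums: "x \<in> E \<Longrightarrow> (\<lambda>n. coeff_fun e n x *\<^sub>R e n) sums x"
  using coeff_fun_sums[OF basis] .

lemma coeff_eqI:
  assumes "x \<in> E" "(\<lambda>n. a n *\<^sub>R e n) sums x"
  shows "coeff_fun e n x = a n"
proof -
  have "\<exists>!a :: nat \<Rightarrow> real. (\<lambda>n. a n *\<^sub>R e n) sums x"
    using basis assms(1) by (simp add: schauder_basis_def)
  from the1_equality[where P = "\<lambda>a. (\<lambda>n. a n *\<^sub>R e n) sums x", OF this assms(2)]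
  show ?thesis by (simp add: coeff_fun_def)
qed

lemma coeff_add:
  assumes "x \<in> E" "y \<in> E"
  shows "coeff_fun e n (x + y) = coeff_fun e n x + coeff_fun e n y"
  using assms subspace_add[OF subspace_E] sums_add[OF coeff_sums coeff_sums]
  by (intro coeff_eqI) (auto simp: scaleR_add_left)

lemma coeff_scaleR:
  assumes "x \<in> E"
  shows "coeff_fun e n (c *\<^sub>R x) = c * coeff_fun e n x"
  using assms subspace_scale[OF subspace_E] sums_scaleR_right[OF coeff_sums, of x c]
  by (intro coeff_eqI) auto

lemma coeff_diff:
  assumes "x \<in> E" "y \<in> E"
  shows "coeff_fun e n (x - y) = coeff_fun e n x - coeff_fun e n y"
  using assms subspace_diff[OF subspace_E] sums_diff[OF coeff_sums coeff_sums]
  by (intro coeff_eqI) (auto simp: scaleR_diff_left)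

lemma coeff_zero [simp]: "coeff_fun e n 0 = 0"
  using coeff_scaleR[OF e_in_E, of n 0] by simp

lemma combination_in_E [simp]: "(\<Sum>k\<in>A. a k *\<^sub>R e k) \<in> E"
  by (intro subspace_sum subspace_scale subspace_E e_in_E)

lemma coeff_combination:
  assumes "finite A"
  shows "coeff_fun e n (\<Sum>k\<in>A. a k *\<^sub>R e k) = (if n \<in> A then a n else 0)"
proof (rule coeff_eqI)
  have "(\<lambda>n. if n \<in> A then a n *\<^sub>R e n else 0) sums (\<Sum>k\<in>A. a k *\<^sub>R e k)"
    using assms by (rule sums_If_finite_set)
  moreover have "(\<lambda>n. if n \<in> A then a n *\<^sub>R e n else 0) = (\<lambda>n. (if n \<in> A then a n else 0) *\<^sub>R e n)"
    by auto
  ultimately show "(\<lambda>n. (if n \<in> A then a n else 0) *\<^sub>R e n) sums (\<Sum>k\<in>A. a k *\<^sub>R e k)" by simp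
qed simp

lemma e_nonzero [simp]: "e n \<noteq> 0"
  using coeff_combination[of "{n}" n "\<lambda>_. 1"] by auto

lemma proj_in_E [simp]: "basis_proj e A x \<in> E"
  by (simp add: basis_proj_def)

lemma coeff_proj:
  "finite A \<Longrightarrow> coeff_fun e n (basis_proj e A x) = (if n \<in> A then coeff_fun e n x else 0)"
  by (simp add: basis_proj_def coeff_combination)

lemma supp_proj:
  "finite A \<Longrightarrow> basis_supp e (basis_proj e A x) = basis_supp e x \<inter> A"
  by (auto simp: basis_supp_def coeff_proj)

lemma proj_add:
  assumes "x \<in> E" "y \<in> E"
  shows "basis_proj e A (x + y) = basis_proj e A x + basis_proj e A y"
  using assms by (simp add: basis_proj_def coeff_add scaleR_add_left sum.distrib)

lemma proj_scaleR:
  assumes "x \<in> E"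
  shows "basis_proj e A (c *\<^sub>R x) = c *\<^sub>R basis_proj e A x"
  using assms by (simp add: basis_proj_def coeff_scaleR scaleR_sum_right)

lemma proj_diff:
  assumes "x \<in> E" "y \<in> E"
  shows "basis_proj e A (x - y) = basis_proj e A x - basis_proj e A y"
  using assms by (simp add: basis_proj_def coeff_diff scaleR_diff_left sum_subtractf)

lemma proj_Un:
  assumes "finite A" "finite B" "A \<inter> B = {}"
  shows "basis_proj e (A \<union> B) x = basis_proj e A x + basis_proj e B x"
  using assms by (simp add: basis_proj_def sum.union_disjoint)

lemma proj_cong_coeff:
  assumes "\<And>n. n \<in> A \<Longrightarrow> coeff_fun e n x = coeff_fun e n y"
  shows "basis_proj e A x = basis_proj e A y"
  using assms by (simp add: basis_proj_def)

lemma proj_LIMSEQ: "x \<in> E \<Longrightarrow> (\<lambda>N. basis_proj e {..<N} x) \<longlonglongrightarrow> x"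
  using coeff_sums unfolding basis_proj_def sums_def by blast

lemma proj_Int_supp: "finite A \<Longrightarrow> basis_proj e (A \<inter> basis_supp e x) x = basis_proj e A x"
  unfolding basis_proj_def basis_supp_def by (rule sum.mono_neutral_left) auto

lemma proj_eq_self:
  assumes "x \<in> E" "finite A" "basis_supp e x \<subseteq> A"
  shows "basis_proj e A x = x"
proof -
  have "(\<lambda>n. coeff_fun e n x *\<^sub>R e n) sums (basis_proj e A x)"
    unfolding basis_proj_def using assms by (intro sums_finite) (auto simp: basis_supp_def)
  then show ?thesis using coeff_sums[OF assms(1)] sums_unique2 by blast
qed

text \<open>By Baire, the closure of the vectors of \<open>E\<close> whose partial sums are all bounded by some fixed
  \<open>n\<close> contains a ball; symmetry and convexity move the ball to the origin.\<close>

lemma approx_by_bounded_partial_sums: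
  "\<exists>L\<ge>0. \<forall>x\<in>E. \<forall>\<epsilon>>0. \<exists>v\<in>E. norm (x - v) < \<epsilon> \<and> (\<forall>N. norm (basis_proj e {..<N} v) \<le> L * norm x)"
proof -
  define V where "V n = {x\<in>E. \<forall>N. norm (basis_proj e {..<N} x) \<le> real n}" for n :: nat
  have VE: "closure (V n) \<subseteq> E" for n
    using closed_E by (intro closure_minimal) (auto simp: V_def)
  have cover: "E \<subseteq> (\<Union>n. V n)"
  proof
    fix x assume x: "x \<in> E"
    have "Bseq (\<lambda>N. basis_proj e {..<N} x)"
      using proj_LIMSEQ[OF x] convergent_imp_Bseq convergent_def by blast
    then obtain K where K: "\<And>N. norm (basis_proj e {..<N} x) \<le> K" unfolding Bseq_def by blast
    obtain n where "K \<le> real n" using real_arch_simple by blast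
    then have "x \<in> V n" using x K order_trans unfolding V_def by blast
    then show "x \<in> (\<Union>n. V n)" by blast
  qed
  have "\<exists>n. top_of_set E interior_of closure (V n) \<noteq> {}"
  proof (rule ccontr)
    assume "\<not> ?thesis"
    then have none: "top_of_set E interior_of closure (V n) = {}" for n by blast
    \<comment> \<open>Baire is applied inside \<open>E\<close>, which is complete as a closed
      subset.\<close>
    have "completely_metrizable_space (top_of_set E)"
      using completely_metrizable_space_closedin[OF completely_metrizable_space_euclidean
          iffD1[OF closed_closedin closed_E]] .
    moreover have "closedin (top_of_set E) (closure (V n))" for n
      using VE by (intro closed_subset) auto
    ultimately have "top_of_set E interior_of \<Union> (range (\<lambda>n. closure (V n))) = {}"
      using none by (intro Baire_category_alt) auto
    moreover have "\<Union> (range (\<lambda>n. closure (V n))) = E"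
    proof (rule antisym)
      show "\<Union> (range (\<lambda>n. closure (V n))) \<subseteq> E" using VE by (rule UN_least)
      show "E \<subseteq> \<Union> (range (\<lambda>n. closure (V n)))"
        using cover by (rule order_trans) (intro UN_mono closure_subset order_refl)
    qed
    ultimately have "E = {}" by (metis interior_of_topspace topspace_euclidean_subtopology)
    then show False using e_in_E by blast
  qed
  then obtain n T x0 where T: "openin (top_of_set E) T" "x0 \<in> T" "T \<subseteq> closure (V n)"
    unfolding interior_of_def by blast
  obtain r where r: "0 < r" "\<And>y. y \<in> E \<Longrightarrow> dist y x0 < r \<Longrightarrow> y \<in> T"
    using T(1,2) unfolding openin_euclidean_subtopology_iff by blast
  have x0: "x0 \<in> E" using T VE by blast
  \<comment> \<open>The vector \<open>y\<close> is half the difference of \<open>x0 + y\<close> and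
    \<open>x0 - y\<close>; half the difference of approximants of these two approximates
    \<open>y\<close> and stays in \<open>V n\<close>.\<close>
  have ball: "\<exists>v\<in>V n. norm (y - v) < \<epsilon>" if y: "y \<in> E" "norm y < r" and \<epsilon>: "0 < \<epsilon>" for y \<epsilon>
  proof -
    have "x0 + y \<in> closure (V n)" "x0 - y \<in> closure (V n)"
      using y x0 T(3) r(2) subspace_add[OF subspace_E] subspace_diff[OF subspace_E]
      by (auto simp: dist_norm intro!: subsetD[OF T(3)] r(2))
    then obtain v1 v2 where v: "v1 \<in> V n" "v2 \<in> V n" "dist v1 (x0 + y) < \<epsilon>" "dist v2 (x0 - y) < \<epsilon>"
      using \<epsilon> unfolding closure_approachable by blast
    then have vE: "v1 \<in> E" "v2 \<in> E" by (auto simp: V_def)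
    define v where "v = (1/2) *\<^sub>R (v1 - v2)"
    have "(x0 + y - v1) - (x0 - y - v2) = 2 *\<^sub>R y - (v1 - v2)" by (simp add: scaleR_2)
    then have "y - v = (1/2) *\<^sub>R ((x0 + y - v1) - (x0 - y - v2))"
      by (simp only: v_def scaleR_diff_right scaleR_scaleR) simp
    then have "norm (y - v) = (1/2) * norm ((x0 + y - v1) - (x0 - y - v2))"
      by (metis norm_scaleR abs_of_pos half_gt_zero_iff zero_less_one)
    moreover have "norm ((x0 + y - v1) - (x0 - y - v2)) < \<epsilon> + \<epsilon>"
      using v(3,4) norm_triangle_ineq4[of "x0 + y - v1" "x0 - y - v2"]
      by (simp add: dist_norm norm_minus_commute)
    ultimately have "norm (y - v) < \<epsilon>" by linarith
    moreover have "v \<in> V n"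
    proof -
      have "norm (basis_proj e {..<N} v) \<le> real n" for N
      proof -
        have "basis_proj e {..<N} v = (1/2) *\<^sub>R (basis_proj e {..<N} v1 - basis_proj e {..<N} v2)"
          unfolding v_def using vE subspace_diff[OF subspace_E] by (simp only: proj_scaleR proj_diff)
        then have "norm (basis_proj e {..<N} v)
            = (1/2) * norm (basis_proj e {..<N} v1 - basis_proj e {..<N} v2)" by simp
        moreover have "norm (basis_proj e {..<N} v1) \<le> real n" "norm (basis_proj e {..<N} v2) \<le> real n"
          using v by (auto simp: V_def)
        ultimately show ?thesis
          using norm_triangle_ineq4[of "basis_proj e {..<N} v1" "basis_proj e {..<N} v2"] by linarith
      qed
      moreover have "v \<in> E"
        unfolding v_def using vE by (intro subspace_scale subspace_diff subspace_E)
      ultimately show ?thesis by (simp add: V_def)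
    qed
    ultimately show ?thesis by blast
  qed
  define L where "L = 2 * real n / r"
  have "\<exists>v\<in>E. norm (x - v) < \<epsilon> \<and> (\<forall>N. norm (basis_proj e {..<N} v) \<le> L * norm x)"
    if x: "x \<in> E" and \<epsilon>: "0 < \<epsilon>" for x \<epsilon>
  proof (cases "x = 0")
    case True
    then show ?thesis using \<epsilon> x by (intro bexI[of _ x]) (auto simp: basis_proj_def)
  next
    case False
    \<comment> \<open>This factor brings \<open>x\<close> to norm \<open>r / 2\<close>, inside the
      ball; undoing it multiplies the bound \<open>n\<close> by \<open>2 * norm x / r\<close>,
      whence \<open>L\<close>.\<close>
    define c where "c = r / (2 * norm x)"
    have c: "0 < c" using False r by (simp add: c_def)
    have "norm (c *\<^sub>R x) < r" using False r(1) by (simp add: c_def)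
    then obtain v where v: "v \<in> V n" "norm (c *\<^sub>R x - v) < c * \<epsilon>"
      using ball[of "c *\<^sub>R x" "c * \<epsilon>"] x c \<epsilon> subspace_scale[OF subspace_E] by auto
    define w where "w = inverse c *\<^sub>R v"
    have vE: "v \<in> E" using v by (simp add: V_def)
    have "c *\<^sub>R (x - w) = c *\<^sub>R x - v" using c by (simp add: w_def scaleR_diff_right)
    then have "c * norm (x - w) < c * \<epsilon>" using v(2) c by (metis norm_scaleR abs_of_pos)
    then have "norm (x - w) < \<epsilon>" using c by simp
    moreover have "norm (basis_proj e {..<N} w) \<le> L * norm x" for N
    proof -
      have "norm (basis_proj e {..<N} w) = inverse c * norm (basis_proj e {..<N} v)"
        using c vE by (simp add: w_def proj_scaleR)
      also have "\<dots> \<le> inverse c * real n"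
        using v(1) c by (intro mult_left_mono) (auto simp: V_def)
      also have "\<dots> = L * norm x" using r(1) False by (simp add: c_def L_def)
      finally show ?thesis .
    qed
    ultimately show ?thesis
      using vE subspace_scale[OF subspace_E] unfolding w_def by blast
  qed
  moreover have "0 \<le> L" using r by (simp add: L_def)
  ultimately show ?thesis by blast
qed

text \<open>Successive approximation, as in the open mapping theorem: \<open>x\<close> is split into
  pieces \<open>v k\<close> whose partial sums decay geometrically in \<open>k\<close>, uniformly in
  the number of terms. Adding up the coefficients of the pieces gives an expansion of
  \<open>x\<close>, and by uniqueness it is the given one.\<close>

theorem basis_constant:
  "\<exists>B\<ge>0. \<forall>x\<in>E. \<forall>N. norm (basis_proj e {..<N} x) \<le> B * norm x"
proof -
  obtain L where L: "0 \<le> L"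
    and appr: "\<And>x \<epsilon>. x \<in> E \<Longrightarrow> 0 < \<epsilon> \<Longrightarrow>
      \<exists>v\<in>E. norm (x - v) < \<epsilon> \<and> (\<forall>N. norm (basis_proj e {..<N} v) \<le> L * norm x)"
    using approx_by_bounded_partial_sums by blast
  have "norm (basis_proj e {..<N} x) \<le> 2 * L * norm x" if x: "x \<in> E" for x N
  proof (cases "x = 0")
    case True
    then show ?thesis by (simp add: basis_proj_def)
  next
    case False
    define D where "D = norm x"
    have D: "0 < D" using False by (simp add: D_def)
    \<comment> \<open>\<open>f k\<close> is the remainder after the first \<open>k\<close> pieces;
      the clause for \<open>k = 0\<close> fixes the starting value of the dependent choice.\<close>
    have "\<exists>f. \<forall>k. (f k \<in> E \<and> norm (f k) \<le> D * (1/2)^k \<and> (k = 0 \<longrightarrow> f k = x)) \<and>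
        (\<forall>N. norm (basis_proj e {..<N} (f k - f (Suc k))) \<le> L * (D * (1/2)^k))"
    proof (rule dependent_nat_choice)
      show "\<exists>y. y \<in> E \<and> norm y \<le> D * (1/2)^0 \<and> (0 = (0::nat) \<longrightarrow> y = x)"
        using x by (simp add: D_def)
      fix y k assume "y \<in> E \<and> norm y \<le> D * (1/2)^k \<and> (k = 0 \<longrightarrow> y = x)"
      then have y: "y \<in> E" "norm y \<le> D * (1/2)^k" by auto
      obtain v where v: "v \<in> E" "norm (y - v) < D * (1/2)^Suc k"
          "\<And>N. norm (basis_proj e {..<N} v) \<le> L * norm y"
        using appr[OF y(1), of "D * (1/2)^Suc k"] D by auto
      have "norm (basis_proj e {..<N} v) \<le> L * (D * (1/2)^k)" for N
        using v(3)[of N] mult_left_mono[OF y(2) L] by linarith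
      then show "\<exists>z. (z \<in> E \<and> norm z \<le> D * (1/2)^Suc k \<and> (Suc k = 0 \<longrightarrow> z = x)) \<and>
          (\<forall>N. norm (basis_proj e {..<N} (y - z)) \<le> L * (D * (1/2)^k))"
        using v(1,2) y(1) subspace_diff[OF subspace_E] by (intro exI[of _ "y - v"]) auto
    qed
    then obtain f where f: "\<And>k. f k \<in> E" "\<And>k. norm (f k) \<le> D * (1/2)^k" "f 0 = x"
      and "\<And>k N. norm (basis_proj e {..<N} (f k - f (Suc k))) \<le> L * (D * (1/2)^k)"
      by blast
    then have fL: "norm (basis_proj e {..<N} (f k - f (Suc k))) \<le> L * D * (1/2)^k" for k N
      by (simp add: mult.assoc)
    define v where "v k = f k - f (Suc k)" for k
    have vE: "v k \<in> E" for k using f(1) subspace_diff[OF subspace_E] by (simp add: v_def)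
    have geo: "summable (\<lambda>k. c * (1/2::real)^k)" "(\<Sum>k. c * (1/2)^k) = 2 * c" for c
    proof -
      have "(\<lambda>k. (1/2::real)^k) sums 2" using geometric_sums[of "1/2::real"] by simp
      then have "(\<lambda>k. c * (1/2::real)^k) sums (c * 2)" by (rule sums_mult)
      then show "summable (\<lambda>k. c * (1/2::real)^k)" "(\<Sum>k. c * (1/2)^k) = 2 * c"
        by (auto simp: sums_iff)
    qed
    have coeff_v: "summable (\<lambda>k. coeff_fun e j (v k))" for j
    proof (rule summable_comparison_test')
      show "summable (\<lambda>k. (2 * L * D / norm (e j)) * (1/2)^k)" by (rule geo)
      fix k
      \<comment> \<open>A single term is the difference of two consecutive partial sums and inherits
        their geometric bound.\<close>
      have "coeff_fun e j (v k) *\<^sub>R e j = basis_proj e {..<Suc j} (v k) - basis_proj e {..<j} (v k)"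
        by (simp add: basis_proj_def)
      then have "\<bar>coeff_fun e j (v k)\<bar> * norm (e j)
          \<le> norm (basis_proj e {..<Suc j} (v k)) + norm (basis_proj e {..<j} (v k))"
        by (metis norm_scaleR norm_triangle_ineq4)
      also have "\<dots> \<le> 2 * L * D * (1/2)^k"
        using fL[of "Suc j" k] fL[of j k] unfolding v_def by linarith
      finally show "norm (coeff_fun e j (v k)) \<le> (2 * L * D / norm (e j)) * (1/2)^k"
        by (simp add: field_simps)
    qed
    define b where "b j = (\<Sum>k. coeff_fun e j (v k))" for j
    define P where "P N = (\<Sum>j<N. b j *\<^sub>R e j)" for N
    have P_sums: "(\<lambda>k. basis_proj e {..<N} (v k)) sums P N" for N
      unfolding P_def basis_proj_def b_def
      by (intro sums_sum sums_scaleR_left summable_sums coeff_v)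
    \<comment> \<open>The first \<open>K\<close> pieces telescope to \<open>x - f K\<close>; the
      others contribute a geometric tail whose bound does not depend on \<open>N\<close>.\<close>
    have tail: "norm (P N - basis_proj e {..<N} (x - f K)) \<le> 2 * L * D * (1/2)^K" for N K
    proof -
      have "(\<Sum>k<K. basis_proj e {..<N} (v k)) = basis_proj e {..<N} (x - f K)"
      proof (induction K)
        case 0
        show ?case using f(3) by (simp add: basis_proj_def)
      next
        case (Suc K)
        have eq: "(x - f K) + v K = x - f (Suc K)" by (simp add: v_def)
        have "x - f K \<in> E" using x f(1) subspace_diff[OF subspace_E] by blast
        from proj_add[OF this vE, of "{..<N}" K]
        show ?case unfolding eq using Suc by simp
      qed
      then have "(\<lambda>k. basis_proj e {..<N} (v (k + K))) sums (P N - basis_proj e {..<N} (x - f K))"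
        using sums_split_initial_segment[OF P_sums, of N K] by simp
      then have eq: "P N - basis_proj e {..<N} (x - f K) = (\<Sum>k. basis_proj e {..<N} (v (k + K)))"
        by (simp add: sums_iff)
      have "norm (basis_proj e {..<N} (v (k + K))) \<le> (L * D * (1/2)^K) * (1/2)^k" for k
        using fL[of N "k + K"] by (simp add: v_def power_add mult_ac)
      then have "norm (\<Sum>k. basis_proj e {..<N} (v (k + K))) \<le> (\<Sum>k. (L * D * (1/2)^K) * (1/2)^k)"
        by (intro norm_suminf_le geo) auto
      then show ?thesis unfolding eq by (simp add: geo)
    qed
    \<comment> \<open>First \<open>K\<close> is fixed to make the tail and the remainder
      \<open>f K\<close> small; then \<open>N\<close> is taken large for the single vector
      \<open>x - f K\<close>.\<close>
    have "P \<longlonglongrightarrow> x"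
    proof (rule LIMSEQ_I)
      fix \<epsilon> :: real assume \<epsilon>: "0 < \<epsilon>"
      define c where "c = 2 * L * D + D"
      have "(\<lambda>K. c * (1/2::real)^K) \<longlonglongrightarrow> 0"
        using geo(1)[of c] by (rule summable_LIMSEQ_zero)
      then have "\<forall>\<^sub>F K in sequentially. c * (1/2)^K < \<epsilon> / 2"
        using \<epsilon> by (intro order_tendstoD) auto
      then obtain K where K: "c * (1/2)^K < \<epsilon> / 2"
        using eventually_happens trivial_limit_sequentially by blast
      have "x - f K \<in> E" using x f(1) subspace_diff[OF subspace_E] by blast
      then obtain n0 where n0: "\<And>N. N \<ge> n0 \<Longrightarrow> norm (basis_proj e {..<N} (x - f K) - (x - f K)) < \<epsilon> / 2"
        using LIMSEQ_D[OF proj_LIMSEQ, of "x - f K" "\<epsilon> / 2"] \<epsilon> by auto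
      have "norm (P N - x) < \<epsilon>" if "N \<ge> n0" for N
      proof -
        have "P N - x = (P N - basis_proj e {..<N} (x - f K))
            + ((basis_proj e {..<N} (x - f K) - (x - f K)) - f K)" by simp
        then have "norm (P N - x) \<le> norm (P N - basis_proj e {..<N} (x - f K))
            + (norm (basis_proj e {..<N} (x - f K) - (x - f K)) + norm (f K))"
          by (metis norm_triangle_mono norm_triangle_ineq4 order_refl)
        also have "\<dots> < 2 * L * D * (1/2)^K + (\<epsilon> / 2 + D * (1/2)^K)"
          using tail[of N K] n0[OF that] f(2)[of K] by linarith
        also have "\<dots> = c * (1/2)^K + \<epsilon> / 2" by (simp add: c_def algebra_simps)
        finally show ?thesis using K by linarith
      qed
      then show "\<exists>n0. \<forall>N\<ge>n0. norm (P N - x) < \<epsilon>" by blast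
    qed
    then have "coeff_fun e j x = b j" for j
      using x unfolding P_def by (intro coeff_eqI) (auto simp: sums_def)
    then have "basis_proj e {..<N} x = P N" by (simp add: basis_proj_def P_def)
    \<comment> \<open>For \<open>K = 0\<close> the vector \<open>x - f 0\<close> is 0 and the tail
      bound is the claim.\<close>
    then show ?thesis using tail[of N 0] f(3) by (simp add: D_def basis_proj_def)
  qed
  then show ?thesis using L by (intro exI[of _ "2 * L"]) auto
qed

end

section \<open>Uniform bounds for semi-normalized bases\<close>

locale semi_normalized_basic_sequence = schauder_basic_sequence +
  assumes semi_norm: "semi_normalized e"
begin

lemma norm_e_bounds: "\<exists>c b. 0 < c \<and> 0 < b \<and> (\<forall>n. c \<le> norm (e n) \<and> norm (e n) \<le> b)"
proof -
  define c where "c = (INF n. norm (e n))"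
  obtain b where b: "\<And>n. norm (e n) \<le> b"
    using semi_norm unfolding semi_normalized_def bdd_above_def by auto
  have "c \<le> norm (e n)" for n
    unfolding c_def by (rule cINF_lower) (auto intro!: bdd_belowI[of _ 0])
  moreover have "0 < c" using semi_norm by (simp add: semi_normalized_def c_def)
  moreover have "0 < b" using b[of 0] calculation order_less_le_trans by blast
  ultimately show ?thesis using b by blast
qed

lemma coeff_bounded: "\<exists>K>0. \<forall>x\<in>E. \<forall>n. \<bar>coeff_fun e n x\<bar> \<le> K * norm x"
proof -
  obtain B where B: "0 \<le> B" "\<And>x N. x \<in> E \<Longrightarrow> norm (basis_proj e {..<N} x) \<le> B * norm x"
    using basis_constant by blast
  obtain c where c: "0 < c" "\<And>n. c \<le> norm (e n)" using norm_e_bounds by blast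
  \<comment> \<open>Consecutive partial sums differ by one term, of norm at most
    \<open>2 * B * norm x\<close>; the added 1 makes the constant positive also for
    \<open>B = 0\<close>.\<close>
  have "\<bar>coeff_fun e n x\<bar> \<le> (2 * B + 1) / c * norm x" if x: "x \<in> E" for x n
  proof -
    have "coeff_fun e n x *\<^sub>R e n = basis_proj e {..<Suc n} x - basis_proj e {..<n} x"
      by (simp add: basis_proj_def)
    then have "\<bar>coeff_fun e n x\<bar> * norm (e n)
        \<le> norm (basis_proj e {..<Suc n} x) + norm (basis_proj e {..<n} x)"
      by (metis norm_scaleR norm_triangle_ineq4)
    also have "\<dots> \<le> (2 * B) * norm x" using B(2)[OF x, of "Suc n"] B(2)[OF x, of n] by simp
    also have "\<dots> \<le> (2 * B + 1) * norm x" by (simp add: algebra_simps)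
    finally have "\<bar>coeff_fun e n x\<bar> * c \<le> (2 * B + 1) * norm x"
      using mult_left_mono[OF c(2)[of n], of "\<bar>coeff_fun e n x\<bar>"] by simp
    then show ?thesis using c(1) by (simp add: field_simps)
  qed
  moreover have "0 < (2 * B + 1) / c" using B(1) c(1) by simp
  ultimately show ?thesis by blast
qed

end

section \<open>Greedy sets\<close>

text \<open>The index sets of greedy sums; like the orderings, they may contain indices of zero
  coefficients once the support is exhausted.\<close>

definition greedy_set :: "(nat \<Rightarrow> 'a::real_normed_vector) \<Rightarrow> 'a \<Rightarrow> nat set \<Rightarrow> bool" where
  "greedy_set e x A \<longleftrightarrow>
     finite A \<and> (\<forall>n\<in>A. \<forall>j. j \<notin> A \<longrightarrow> \<bar>coeff_fun e j x\<bar> \<le> \<bar>coeff_fun e n x\<bar>)"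

lemma greedy_set_finite: "greedy_set e x A \<Longrightarrow> finite A"
  by (simp add: greedy_set_def)

lemma greedy_setD:
  "greedy_set e x A \<Longrightarrow> n \<in> A \<Longrightarrow> j \<notin> A \<Longrightarrow> \<bar>coeff_fun e j x\<bar> \<le> \<bar>coeff_fun e n x\<bar>"
  by (simp add: greedy_set_def)

lemma greedy_set_initial_segment:
  assumes "\<pi> \<in> greedy_orderings e x"
  shows "greedy_set e x (\<pi> ` {..<m})" "card (\<pi> ` {..<m}) = m"
    "greedy_sum e \<pi> m x = basis_proj e (\<pi> ` {..<m}) x"
proof -
  have \<pi>: "inj \<pi>" "basis_supp e x \<subseteq> range \<pi>" "decseq (\<lambda>n. \<bar>coeff_fun e (\<pi> n) x\<bar>)"
    using assms by (auto simp: greedy_orderings_def)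
  have inj: "inj_on \<pi> {..<m}" using \<pi>(1) by (rule inj_on_subset) simp
  have "\<bar>coeff_fun e j x\<bar> \<le> \<bar>coeff_fun e (\<pi> i) x\<bar>" if "i < m" "j \<notin> \<pi> ` {..<m}" for i j
  proof (cases "j \<in> range \<pi>")
    case True
    then obtain k where k: "j = \<pi> k" by blast
    then have "i \<le> k" using that by (meson imageI lessThan_iff less_imp_le not_le order_less_le_trans)
    then show ?thesis using \<pi>(3) unfolding decseq_def k by blast
  next
    case False
    then have "coeff_fun e j x = 0" using \<pi>(2) by (auto simp: basis_supp_def)
    then show ?thesis by simp
  qed
  then show "greedy_set e x (\<pi> ` {..<m})" by (auto simp: greedy_set_def)
  show "card (\<pi> ` {..<m}) = m" using card_image[OF inj] by simp
  show "greedy_sum e \<pi> m x = basis_proj e (\<pi> ` {..<m}) x"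
    using inj by (simp add: greedy_sum_def basis_proj_def sum.reindex)
qed

lemma finite_down_closed_nat_eq:
  fixes I :: "nat set"
  assumes "finite I" "\<And>i k. i \<in> I \<Longrightarrow> k \<le> i \<Longrightarrow> k \<in> I"
  shows "I = {..<card I}"
proof -
  have "i < card I" if "i \<in> I" for i
  proof -
    have "{..i} \<subseteq> I" using assms(2) that by auto
    then have "card {..i} \<le> card I" using assms(1) by (intro card_mono)
    then show ?thesis by simp
  qed
  then have "I \<subseteq> {..<card I}" by auto
  then show ?thesis by (intro card_subset_eq) simp_all
qed

context semi_normalized_basic_sequence
begin

text \<open>Raising the moduli of the coefficients on a greedy set by 1 puts that set first in every
  greedy ordering, without otherwise changing which orderings are greedy.\<close>

lemma greedy_set_realized:
  assumes x: "x \<in> E" and A: "greedy_set e x A"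
  shows "\<exists>\<pi>\<in>greedy_orderings e x. \<pi> ` {..<card A} = A"
proof -
  define c where "c n = coeff_fun e n x" for n
  \<comment> \<open>The value 1 at a zero coefficient makes the modulus grow by exactly 1 there,
    too.\<close>
  define sg where "sg n = (if c n < 0 then - 1 else 1 :: real)" for n
  define x' where "x' = x + (\<Sum>n\<in>A. sg n *\<^sub>R e n)"
  define b where "b n = \<bar>coeff_fun e n x'\<bar>" for n
  have fin: "finite A" using A by (rule greedy_set_finite)
  have x': "x' \<in> E" unfolding x'_def using x subspace_add[OF subspace_E] by simp
  have b: "b n = \<bar>c n\<bar> + (if n \<in> A then 1 else 0)" for n
    using x by (simp add: b_def x'_def coeff_add coeff_combination[OF fin] c_def[symmetric] sg_def)
  obtain \<pi> where "\<pi> \<in> greedy_orderings e x'"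
    using greedy_orderings_nonempty[OF basis semi_norm x'] by blast
  then have \<pi>: "inj \<pi>" "basis_supp e x' \<subseteq> range \<pi>" and dec: "\<And>i k. i \<le> k \<Longrightarrow> b (\<pi> k) \<le> b (\<pi> i)"
    by (auto simp: greedy_orderings_def decseq_def b_def)
  have supp': "n \<in> range \<pi>" if "b n \<noteq> 0" for n
    using \<pi>(2) that by (auto simp: basis_supp_def b_def)
  have g: "\<bar>c j\<bar> \<le> \<bar>c n\<bar>" if "n \<in> A" "j \<notin> A" for n j
    using greedy_setD[OF A that] by (simp add: c_def)
  \<comment> \<open>The values of \<open>b\<close> on \<open>A\<close> exceed those off
    \<open>A\<close> by at least 1, so no index outside \<open>A\<close> precedes one
    inside.\<close>
  have down: "\<pi> i \<in> A" if "\<pi> k \<in> A" "i \<le> k" for i k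
    using dec[OF that(2)] g[OF that(1), of "\<pi> i"] that(1) by (auto simp: b split: if_splits)
  have "n \<in> range \<pi>" if "n \<in> A" for n
    using that b[of n] by (intro supp') simp
  then have A_range: "A \<subseteq> range \<pi>" by blast
  have "\<pi> -` A = {..<card (\<pi> -` A)}"
    by (rule finite_down_closed_nat_eq) (use finite_vimageI[OF fin \<pi>(1)] down in auto)
  then have "\<pi> ` {..<card A} = A"
    using card_vimage_inj[OF \<pi>(1) A_range] image_vimage_eq[of \<pi> A] A_range by auto
  moreover have "\<pi> \<in> greedy_orderings e x"
  proof -
    have "n \<in> range \<pi>" if "n \<in> basis_supp e x" for n
      using that b[of n] by (intro supp') (auto simp: basis_supp_def c_def add_nonneg_eq_0_iff)
    then have "basis_supp e x \<subseteq> range \<pi>" by blast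
    \<comment> \<open>Two indices on the same side of \<open>A\<close> are shifted equally; an index
      of \<open>A\<close> before one outside is covered by greediness; the opposite order is
      excluded by \<open>down\<close>.\<close>
    moreover have "\<bar>c (\<pi> k)\<bar> \<le> \<bar>c (\<pi> i)\<bar>" if "i \<le> k" for i k
      using dec[OF that] down[OF _ that] g[of "\<pi> i" "\<pi> k"] by (auto simp: b split: if_splits)
    ultimately show ?thesis
      using \<pi>(1) by (simp add: greedy_orderings_def decseq_def c_def)
  qed
  ultimately show ?thesis by blast
qed

text \<open>This replaces manipulations of orderings by set operations in the estimates that
  follow.\<close>

lemma greedy_sums_eq:
  assumes "x \<in> E"
  shows "greedy_sums e m x = {basis_proj e A x |A. greedy_set e x A \<and> card A = m}"
proof (rule set_eqI)
  fix s
  have "s \<in> greedy_sums e m x \<longleftrightarrow> (\<exists>\<pi>\<in>greedy_orderings e x. s = basis_proj e (\<pi> ` {..<m}) x)"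
    unfolding greedy_sums_def image_iff
    by (rule bex_cong) (simp_all add: greedy_set_initial_segment(3))
  also have "\<dots> \<longleftrightarrow> (\<exists>A. greedy_set e x A \<and> card A = m \<and> s = basis_proj e A x)"
    using greedy_set_initial_segment(1,2) greedy_set_realized[OF assms] by metis
  finally show "s \<in> greedy_sums e m x \<longleftrightarrow> s \<in> {basis_proj e A x |A. greedy_set e x A \<and> card A = m}"
    by auto
qed

lemma greedy_set_Int_supp:
  assumes "greedy_set e x A"
  shows "greedy_set e x (A \<inter> basis_supp e x)"
  using assms by (auto simp: greedy_set_def basis_supp_def)

lemma greedy_set_scaleR:
  assumes "x \<in> E" "greedy_set e x A"
  shows "greedy_set e (c *\<^sub>R x) A"
  using assms by (auto simp: greedy_set_def coeff_scaleR abs_mult intro: mult_left_mono)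

end

section \<open>The sequence of greedy sums\<close>

text \<open>Each of the \<open>j + 1\<close> blocks contributes at least one entry, so the lookup in
  \<open>greedy_seq\<close> is in range.\<close>

lemma length_concat_upt_ge:
  assumes "\<And>m. f m \<noteq> []"
  shows "j < length (concat (map f [1..<j + 2]))"
proof (induction j)
  case 0
  then show ?case using assms[of 1] by simp
next
  case (Suc j)
  have "concat (map f [1..<Suc j + 2]) = concat (map f [1..<j + 2]) @ f (j + 2)" by simp
  moreover have "length (f (j + 2)) \<noteq> 0" using assms by simp
  ultimately show ?case using Suc by (simp only: length_append)
qed

text \<open>The list inside \<open>greedy_seq\<close> varies with the position looked up; this makes
  different truncations agree wherever the shorter one is defined.\<close>

lemma nth_concat_upt_prefix:
  assumes "1 \<le> p" "p \<le> q" "i < length (concat (map f [1..<p]))"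
  shows "concat (map f [1..<q]) ! i = concat (map f [1..<p]) ! i"
proof -
  have "[1..<q] = [1..<p] @ [p..<q]"
    using upt_add_eq_append[of 1 p "q - p"] assms by simp
  then show ?thesis using assms(3) by (simp add: nth_append)
qed

context semi_normalized_basic_sequence
begin

lemma greedy_seq_surj:
  assumes x: "x \<in> E" and m: "1 \<le> m" and s: "s \<in> greedy_sums e m x"
  shows "\<exists>j. greedy_seq e x j = s"
proof -
  note block = greedy_block[OF basis semi_norm x]
  define f where "f m = greedy_block e m x" for m
  have "s \<in> set (concat (map f [1..<m + 1]))"
    using block(2) s m by (auto simp: f_def)
  then obtain i where i: "i < length (concat (map f [1..<m + 1]))" "concat (map f [1..<m + 1]) ! i = s"
    by (metis in_set_conv_nth)
  have i2: "i < length (concat (map f [1..<i + 2]))"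
    by (rule length_concat_upt_ge) (simp add: f_def block)
  have "concat (map f [1..<i + 2]) ! i = concat (map f [1..<m + 1]) ! i"
  proof (cases "i + 2 \<le> m + 1")
    case True
    then show ?thesis using nth_concat_upt_prefix[OF _ True i2] by (simp del: upt_Suc)
  next
    case False
    then have "m + 1 \<le> i + 2" by simp
    then show ?thesis using nth_concat_upt_prefix[OF _ _ i(1), of "i + 2"] by (simp del: upt_Suc)
  qed
  then have "greedy_seq e x i = s" using i(2) by (simp add: greedy_seq_def f_def[abs_def] del: upt_Suc)
  then show ?thesis by blast
qed

lemma greedy_seq_tail:
  assumes x: "x \<in> E" and M: "1 \<le> M"
  shows "\<exists>j0. \<forall>j\<ge>j0. \<exists>m\<ge>M. greedy_seq e x j \<in> greedy_sums e m x"
proof -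
  note block = greedy_block[OF basis semi_norm x]
  define f where "f m = greedy_block e m x" for m
  define l where "l = length (concat (map f [1..<M]))"
  \<comment> \<open>From position \<open>l\<close> on the first \<open>M - 1\<close> blocks are
    exhausted, and \<open>j\<close> being at least \<open>M\<close> ensures that the truncated list
    reaches block \<open>M\<close>.\<close>
  have "\<exists>m\<ge>M. greedy_seq e x j \<in> greedy_sums e m x" if j: "j \<ge> max M l" for j
  proof -
    have split: "[1..<j + 2] = [1..<M] @ [M..<j + 2]"
      using upt_add_eq_append[of 1 M "j + 2 - M"] M j by simp
    have "j < length (concat (map f [1..<j + 2]))"
      by (rule length_concat_upt_ge) (simp add: f_def block)
    then have "j < l + length (concat (map f [M..<j + 2]))"
      unfolding split by (simp only: map_append concat_append length_append l_def)
    then have len: "j - l < length (concat (map f [M..<j + 2]))" using j by linarith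
    have "greedy_seq e x j = concat (map f [M..<j + 2]) ! (j - l)"
      unfolding greedy_seq_def f_def[symmetric] split
      using j by (simp add: nth_append l_def del: upt_Suc)
    then have "greedy_seq e x j \<in> set (concat (map f [M..<j + 2]))"
      using nth_mem[OF len] by metis
    then show ?thesis using block(2) by (auto simp: f_def)
  qed
  then show ?thesis by blast
qed

end

section \<open>Maximal functions of greedy sums\<close>

locale lattice_basic_sequence = semi_normalized_basic_sequence e E
  for e :: "nat \<Rightarrow> 'a::banach_lattice" and E
begin

lemma greedy_max_le_iff:
  assumes "1 \<le> m"
  shows "greedy_max e \<pi> m x \<le> u \<longleftrightarrow> (\<forall>n\<in>{1..m}. \<bar>greedy_sum e \<pi> n x\<bar> \<le> u)"
  unfolding greedy_max_def using assms by (subst Sup_fin.bounded_iff) auto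

text \<open>Through its upper bounds the nested supremum can be estimated one greedy set at a
  time.\<close>

lemma greedy_max_all_le_iff:
  assumes x: "x \<in> E" and m: "1 \<le> m"
  shows "greedy_max_all e m x \<le> u \<longleftrightarrow>
    (\<forall>A. greedy_set e x A \<longrightarrow> 1 \<le> card A \<longrightarrow> card A \<le> m \<longrightarrow> \<bar>basis_proj e A x\<bar> \<le> u)"
proof -
  have "greedy_max_all e m x \<le> u \<longleftrightarrow> (\<forall>\<pi>\<in>greedy_orderings e x. greedy_max e \<pi> m x \<le> u)"
    unfolding greedy_max_all_def
    using greedy_orderings_nonempty[OF basis semi_norm x] finite_greedy_max_set[OF basis semi_norm x]
    by (subst Sup_fin.bounded_iff) auto
  also have "\<dots> \<longleftrightarrow> (\<forall>n\<in>{1..m}. \<forall>s\<in>greedy_sums e n x. \<bar>s\<bar> \<le> u)"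
    using greedy_max_le_iff[OF m] by (auto simp: greedy_sums_def)
  also have "\<dots> \<longleftrightarrow> (\<forall>A. greedy_set e x A \<longrightarrow> 1 \<le> card A \<longrightarrow> card A \<le> m \<longrightarrow> \<bar>basis_proj e A x\<bar> \<le> u)"
    unfolding greedy_sums_eq[OF x] by fastforce
  finally show ?thesis .
qed

lemma greedy_max_all_nonneg:
  assumes x: "x \<in> E" and m: "1 \<le> m"
  shows "0 \<le> greedy_max_all e m x"
proof -
  obtain \<pi> where "\<pi> \<in> greedy_orderings e x"
    using greedy_orderings_nonempty[OF basis semi_norm x] by blast
  then have "\<bar>basis_proj e (\<pi> ` {..<m}) x\<bar> \<le> greedy_max_all e m x"
    using greedy_set_initial_segment[of \<pi> e x m] greedy_max_all_le_iff[OF assms, of "greedy_max_all e m x"] m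
    by auto
  then show ?thesis using abs_ge_zero order_trans by blast
qed

text \<open>The suprema start at one term, so for the empty set the bound comes from
  nonnegativity.\<close>

lemma greedy_proj_le:
  assumes x: "x \<in> E" and m: "1 \<le> m" and A: "greedy_set e x A" "card A \<le> m"
  shows "\<bar>basis_proj e A x\<bar> \<le> greedy_max_all e m x"
proof (cases "A = {}")
  case True
  then show ?thesis using greedy_max_all_nonneg[OF x m] by (simp add: basis_proj_def)
next
  case False
  then have "1 \<le> card A" using greedy_set_finite[OF A(1)] by (simp add: Suc_leI card_gt_0_iff)
  then show ?thesis using greedy_max_all_le_iff[OF x m, of "greedy_max_all e m x"] A by blast
qed

lemma norm_greedy_max_all_le:
  assumes "x \<in> E" "1 \<le> m" "greedy_max_all e m x \<le> u"
  shows "norm (greedy_max_all e m x) \<le> norm u"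
  using assms greedy_max_all_nonneg by (intro norm_le_if_abs_le) simp

lemma greedy_max_all_scaleR:
  assumes x: "x \<in> E" and m: "1 \<le> m" and c: "0 < c"
  shows "c * norm (greedy_max_all e m x) \<le> norm (greedy_max_all e m (c *\<^sub>R x))"
proof -
  have cx: "c *\<^sub>R x \<in> E" using x subspace_scale[OF subspace_E] by blast
  have "\<bar>basis_proj e A x\<bar> \<le> greedy_max_all e m (c *\<^sub>R x) /\<^sub>R c"
    if A: "greedy_set e x A" "card A \<le> m" for A
  proof -
    have "c *\<^sub>R \<bar>basis_proj e A x\<bar> = \<bar>basis_proj e A (c *\<^sub>R x)\<bar>"
      using x c by (simp add: proj_scaleR abs_scaleR_lattice)
    also have "\<dots> \<le> greedy_max_all e m (c *\<^sub>R x)"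
      using cx m greedy_set_scaleR[OF x A(1)] A(2) by (rule greedy_proj_le)
    finally show ?thesis using c by (simp add: pos_le_divideR_eq)
  qed
  then have "greedy_max_all e m x \<le> greedy_max_all e m (c *\<^sub>R x) /\<^sub>R c"
    using greedy_max_all_le_iff[OF x m] by blast
  then have "norm (greedy_max_all e m x) \<le> norm (greedy_max_all e m (c *\<^sub>R x)) / c"
    using norm_greedy_max_all_le[OF x m] c by (force simp: divide_inverse mult.commute)
  then show ?thesis using c by (simp add: field_simps)
qed

section \<open>From order convergence to order and norm bounds\<close>

text \<open>Every greedy sum of every ordering is an entry of the sequence, so one bound for the
  sequence serves all orderings.\<close>

lemma order_bounded_if_order_conv:
  assumes x: "x \<in> E" and conv: "order_conv (greedy_seq e x) x"
  shows "\<exists>u. \<forall>\<pi>\<in>greedy_orderings e x. \<forall>m\<ge>1. greedy_max e \<pi> m x \<le> u"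
proof -
  obtain u where u: "\<And>j. \<bar>greedy_seq e x j\<bar> \<le> u" using order_conv_imp_bounded[OF conv] by blast
  have "\<bar>greedy_sum e \<pi> n x\<bar> \<le> u" if "\<pi> \<in> greedy_orderings e x" "1 \<le> n" for \<pi> n
    using greedy_seq_surj[OF x that(2), of "greedy_sum e \<pi> n x"] that(1) u
    by (metis greedy_sums_def imageI)
  then show ?thesis using greedy_max_le_iff by (metis atLeastAtMost_iff)
qed

lemma norm_bounded_if_order_bounded:
  assumes x: "x \<in> E" and u: "\<forall>\<pi>\<in>greedy_orderings e x. \<forall>m\<ge>1. greedy_max e \<pi> m x \<le> u"
  shows "\<exists>C>0. \<forall>m\<ge>1. norm (greedy_max_all e m x) \<le> C"
proof -
  have "norm (greedy_max_all e m x) \<le> norm u + 1" if m: "1 \<le> m" for m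
  proof -
    have "greedy_max_all e m x \<le> u"
      unfolding greedy_max_all_def
      using greedy_orderings_nonempty[OF basis semi_norm x]
        finite_greedy_max_set[OF basis semi_norm x] u m
      by (subst Sup_fin.bounded_iff) auto
    then show ?thesis using norm_greedy_max_all_le[OF x m] by force
  qed
  then show ?thesis by (intro exI[of _ "norm u + 1"]) (auto simp: add_nonneg_pos)
qed

section \<open>From the maximal inequality to uniform convergence\<close>

definition level_set :: "'a \<Rightarrow> real \<Rightarrow> nat set" where
  "level_set x t = {n. t \<le> \<bar>coeff_fun e n x\<bar>}"

lemma finite_level_set: "x \<in> E \<Longrightarrow> 0 < t \<Longrightarrow> finite (level_set x t)"
  unfolding level_set_def using finite_large_coeff[OF basis semi_norm] by blast

lemma greedy_set_level_set: "x \<in> E \<Longrightarrow> 0 < t \<Longrightarrow> greedy_set e x (level_set x t)"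
  using finite_level_set[of x t] by (auto simp: greedy_set_def level_set_def)

text \<open>If an index of the level set is missing from \<open>A\<close>, all coefficients on
  \<open>A\<close> are at least as large in modulus, hence reach the level \<open>t\<close>.\<close>

lemma greedy_set_level_set_cases:
  assumes "greedy_set e x A"
  shows "level_set x t \<subseteq> A \<or> A \<subseteq> level_set x t"
proof -
  have "j \<in> level_set x t" if "n \<in> level_set x t" "n \<notin> A" "j \<in> A" for n j
    using that greedy_setD[OF assms that(3,2)] by (simp add: level_set_def)
  then show ?thesis by blast
qed

definition maximal_inequality :: "real \<Rightarrow> bool" where
  "maximal_inequality C \<longleftrightarrow> (\<forall>m\<ge>1. \<forall>x\<in>E. finite (basis_supp e x) \<longrightarrow>
     norm (greedy_max_all e m x) \<le> C * norm x)"

text \<open>The inequality is given for finite supports. For \<open>M\<close> beyond the level set,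
  truncating \<open>z\<close> to \<open>M\<close> coordinates keeps that set greedy and its
  projection unchanged; then \<open>M\<close> tends to infinity.\<close>

lemma norm_proj_level_set_le:
  assumes C: "maximal_inequality C" and z: "z \<in> E" and t: "0 < t"
  shows "norm (basis_proj e (level_set z t) z) \<le> C * norm z"
proof -
  define A where "A = level_set z t"
  have A: "finite A" using finite_level_set[OF z t] by (simp add: A_def)
  then obtain N where N: "A \<subseteq> {..<N}" using finite_nat_iff_bounded by blast
  have le: "norm (basis_proj e A z) \<le> C * norm (basis_proj e {..<M} z)" if M: "M \<ge> N" for M
  proof -
    let ?y = "basis_proj e {..<M} z"
    have c: "coeff_fun e n ?y = (if n < M then coeff_fun e n z else 0)" for n
      by (simp add: coeff_proj)
    have AM: "A \<subseteq> {..<M}" using N M by auto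
    then have "greedy_set e ?y A"
      using greedy_set_level_set[OF z t] unfolding A_def[symmetric] greedy_set_def by (auto simp: c)
    \<comment> \<open>The 1 keeps the number of terms positive if \<open>A\<close> is empty.\<close>
    then have "\<bar>basis_proj e A ?y\<bar> \<le> greedy_max_all e (card A + 1) ?y"
      by (intro greedy_proj_le) auto
    moreover have "basis_proj e A ?y = basis_proj e A z"
      using AM by (intro proj_cong_coeff) (auto simp: c)
    ultimately have "norm (basis_proj e A z) \<le> norm (greedy_max_all e (card A + 1) ?y)"
      by (metis norm_le_if_abs_le)
    also have "\<dots> \<le> C * norm ?y"
      using C unfolding maximal_inequality_def by (auto simp: supp_proj)
    finally show ?thesis .
  qed
  have "(\<lambda>M. C * norm (basis_proj e {..<M} z)) \<longlonglongrightarrow> C * norm z"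
    by (intro tendsto_intros proj_LIMSEQ z)
  then show ?thesis
    using le unfolding A_def by (intro LIMSEQ_le_const) auto
qed

text \<open>Removing a long partial sum leaves a small rest \<open>z\<close>. Once \<open>t\<close>
  is at most every nonzero modulus among the first \<open>N\<close> coefficients, the level set of
  \<open>x\<close> consists of those indices and the level set of \<open>z\<close>, so the error is
  the level projection of \<open>z\<close> minus \<open>z\<close>.\<close>

lemma level_set_proj_approx:
  assumes C: "maximal_inequality C" "0 \<le> C" and x: "x \<in> E" and \<epsilon>: "0 < \<epsilon>"
  shows "\<exists>d>0. \<forall>t. 0 < t \<longrightarrow> t \<le> d \<longrightarrow> norm (basis_proj e (level_set x t) x - x) \<le> \<epsilon>"
proof -
  define \<eta> where "\<eta> = \<epsilon> / (C + 1)"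
  have \<eta>: "0 < \<eta>" "(C + 1) * \<eta> = \<epsilon>" using \<epsilon> C(2) by (auto simp: \<eta>_def)
  obtain N where N: "norm (basis_proj e {..<N} x - x) < \<eta>"
    using LIMSEQ_D[OF proj_LIMSEQ[OF x] \<eta>(1)] by blast
  define z where "z = x - basis_proj e {..<N} x"
  have z: "z \<in> E" unfolding z_def using x subspace_diff[OF subspace_E] by simp
  have nz: "norm z < \<eta>" using N by (simp add: z_def norm_minus_commute)
  have cz: "coeff_fun e n z = (if n < N then 0 else coeff_fun e n x)" for n
    using x by (simp add: z_def coeff_diff coeff_proj)
  define F where "F = {..<N} \<inter> basis_supp e x"
  \<comment> \<open>Inserting 1 covers the case of empty \<open>F\<close>.\<close>
  define d where "d = Min (insert 1 ((\<lambda>n. \<bar>coeff_fun e n x\<bar>) ` F))"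
  have F: "finite F" by (simp add: F_def)
  then have d0: "0 < d" by (auto simp: d_def F_def basis_supp_def)
  have dF: "d \<le> \<bar>coeff_fun e n x\<bar>" if "n \<in> F" for n
    using F that by (simp add: d_def)
  have "norm (basis_proj e (level_set x t) x - x) \<le> \<epsilon>" if t: "0 < t" "t \<le> d" for t
  proof -
    have L: "level_set x t = F \<union> level_set z t"
    proof -
      have "n \<in> F \<longleftrightarrow> n < N \<and> t \<le> \<bar>coeff_fun e n x\<bar>" for n
        using dF[of n] t by (auto simp: F_def basis_supp_def)
      then show ?thesis using t(1) by (auto simp: level_set_def cz)
    qed
    have disj: "F \<inter> level_set z t = {}" using t(1) by (auto simp: F_def level_set_def cz)
    have "basis_proj e (level_set x t) x = basis_proj e F x + basis_proj e (level_set z t) x"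
      unfolding L using F finite_level_set[OF z t(1)] disj by (rule proj_Un)
    also have "basis_proj e F x = basis_proj e {..<N} x" by (simp add: F_def proj_Int_supp)
    also have "basis_proj e (level_set z t) x = basis_proj e (level_set z t) z"
      using t(1) by (intro proj_cong_coeff) (auto simp: level_set_def cz split: if_splits)
    finally have "basis_proj e (level_set x t) x - x = basis_proj e (level_set z t) z - z"
      by (simp add: z_def)
    then have "norm (basis_proj e (level_set x t) x - x) \<le> norm (basis_proj e (level_set z t) z) + norm z"
      by (simp add: norm_triangle_ineq4)
    also have "\<dots> \<le> (C + 1) * norm z"
      using norm_proj_level_set_le[OF C(1) z t(1)] by (simp add: algebra_simps)
    also have "\<dots> \<le> (C + 1) * \<eta>" using nz C(2) by (intro mult_left_mono) auto
    finally show ?thesis using \<eta>(2) by simp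
  qed
  then show ?thesis using d0 by blast
qed

text \<open>Greedy sums between two consecutive level sets differ from the lower one by a greedy sum of
  the difference of the two level projections.\<close>

lemma greedy_proj_between_levels:
  assumes x: "x \<in> E" and A: "greedy_set e x A"
    and L: "finite L" "L \<subseteq> A" and L': "finite L'" "A \<subseteq> L'"
  shows "\<bar>basis_proj e A x - x\<bar> \<le> \<bar>basis_proj e L x - x\<bar>
    + greedy_max_all e (card L' + 1) (basis_proj e (L' - L) x)"
proof -
  define v where "v = basis_proj e (L' - L) x"
  have c: "coeff_fun e n v = (if n \<in> L' - L then coeff_fun e n x else 0)" for n
    using L'(1) by (simp add: v_def coeff_proj)
  have fin: "finite A" using A by (rule greedy_set_finite)
  have "greedy_set e v (A - L)"
    using A L' unfolding greedy_set_def by (auto simp: c)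
  moreover have "card (A - L) \<le> card L' + 1"
    using card_mono[OF L'(1), of "A - L"] L'(2) by fastforce
  ultimately have "\<bar>basis_proj e (A - L) v\<bar> \<le> greedy_max_all e (card L' + 1) v"
    by (intro greedy_proj_le) (auto simp: v_def)
  moreover have "basis_proj e (A - L) v = basis_proj e (A - L) x"
    using L' by (intro proj_cong_coeff) (auto simp: c)
  moreover have "basis_proj e A x - x = (basis_proj e L x - x) + basis_proj e (A - L) x"
    using proj_Un[of L "A - L" x] L fin by (simp add: Un_absorb1)
  ultimately show ?thesis
    unfolding v_def[symmetric] by (simp only: abs_add_le_add)
qed

lemma uniform_conv_if_maximal_inequality:
  assumes C: "maximal_inequality C" "0 \<le> C" and x: "x \<in> E"
  shows "uniform_conv (greedy_seq e x) x"
proof -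
  define T where "T t = basis_proj e (level_set x t) x" for t
  \<comment> \<open>The bound \<open>1 / real (k + 1)\<close> makes the level sets exhaust the
    support; monotonicity makes them nested.\<close>
  have "\<exists>t. \<forall>k. (0 < t k \<and> t k \<le> 1 / real (k + 1) \<and> norm (T (t k) - x) \<le> (1/4)^k) \<and> t (Suc k) \<le> t k"
  proof (rule dependent_nat_choice)
    have step: "\<exists>s. (0 < s \<and> s \<le> 1 / real (k + 1) \<and> norm (T s - x) \<le> (1/4)^k) \<and> s \<le> r"
      if r: "0 < r" for k r
    proof -
      obtain d where d: "0 < d" "\<And>t. 0 < t \<Longrightarrow> t \<le> d \<Longrightarrow> norm (T t - x) \<le> (1/4)^k"
        using level_set_proj_approx[OF C x, of "(1/4)^k"] unfolding T_def by auto
      show ?thesis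
        using r d by (intro exI[of _ "min d (min r (1 / real (k + 1)))"]) auto
    qed
    show "\<exists>s. 0 < s \<and> s \<le> 1 / real (0 + 1) \<and> norm (T s - x) \<le> (1/4)^0"
      using step[of 1 0] by auto
    show "\<exists>s. (0 < s \<and> s \<le> 1 / real (Suc k + 1) \<and> norm (T s - x) \<le> (1/4)^Suc k) \<and> s \<le> r"
      if "0 < r \<and> r \<le> 1 / real (k + 1) \<and> norm (T r - x) \<le> (1/4)^k" for r k
      using step[of r "Suc k"] that by blast
  qed
  then obtain t where t: "\<And>k. 0 < t k" "\<And>k. t k \<le> 1 / real (k + 1)"
      "\<And>k. norm (T (t k) - x) \<le> (1/4)^k" "\<And>k. t (Suc k) \<le> t k"
    by blast
  define L where "L k = level_set x (t k)" for k
  have finL: "finite (L k)" for k using finite_level_set[OF x t(1)] by (simp add: L_def)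
  have Lsub: "L k \<subseteq> L (Suc k)" for k using t(4)[of k] by (auto simp: L_def level_set_def)
  have TL: "T (t k) = basis_proj e (L k) x" for k by (simp add: T_def L_def)
  define v where "v k = basis_proj e (L (Suc k) - L k) x" for k
  define w where "w k = \<bar>T (t k) - x\<bar> + greedy_max_all e (card (L (Suc k)) + 1) (v k)" for k
  have vE: "v k \<in> E" for k by (simp add: v_def)
  have w0: "0 \<le> w k" for k
    using greedy_max_all_nonneg[OF vE, of "card (L (Suc k)) + 1" k] by (simp add: w_def)
  have w_norm: "norm (w k) \<le> (1 + 2 * C) * (1/4)^k" for k
  proof -
    have "v k = (T (t (Suc k)) - x) - (T (t k) - x)"
      using proj_Un[of "L k" "L (Suc k) - L k" x] finL Lsub[of k] by (simp add: v_def TL Un_absorb1)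
    then have "norm (v k) \<le> norm (T (t (Suc k)) - x) + norm (T (t k) - x)"
      by (metis norm_triangle_ineq4)
    also have "\<dots> \<le> (1/4)^Suc k + (1/4)^k" using t(3) by (intro add_mono)
    also have "\<dots> \<le> 2 * (1/4)^k" by simp
    finally have v: "norm (v k) \<le> 2 * (1/4)^k" .
    have "norm (greedy_max_all e (card (L (Suc k)) + 1) (v k)) \<le> C * norm (v k)"
      using C(1) vE finL unfolding maximal_inequality_def by (auto simp: v_def supp_proj)
    also have "\<dots> \<le> C * (2 * (1/4)^k)" using v C(2) by (rule mult_left_mono)
    finally have "norm (w k) \<le> norm \<bar>T (t k) - x\<bar> + C * (2 * (1/4)^k)"
      unfolding w_def by (meson add_left_mono norm_triangle_ineq order_trans)
    also have "\<dots> \<le> (1/4)^k + C * (2 * (1/4)^k)"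
      using t(3)[of k] by (simp add: norm_abs_lattice)
    finally show ?thesis by (simp add: algebra_simps)
  qed
  \<comment> \<open>Since \<open>w k\<close> decays like 4^-k, the weights 2^k still give a summable
    series, and its sum dominates \<open>w k\<close> with a factor 2^-k to spare.\<close>
  define f where "f k = (2::real)^k *\<^sub>R w k" for k
  have sum_f: "summable f"
  proof (rule summable_comparison_test')
    show "summable (\<lambda>k. (1 + 2 * C) * (1/2::real)^k)" by (intro summable_mult summable_geometric) simp
    fix k
    have "norm (f k) \<le> 2^k * ((1 + 2 * C) * (1/4)^k)"
      using w_norm[of k] by (simp add: f_def)
    also have "(2::real)^k * ((1 + 2 * C) * (1/4)^k) = (1 + 2 * C) * (2^k * (1/4)^k)" by simp
    also have "(2::real)^k * (1/4)^k = (1/2)^k" by (simp flip: power_mult_distrib)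
    finally show "norm (f k) \<le> (1 + 2 * C) * (1/2)^k" .
  qed
  define u where "u = suminf f"
  have f0: "0 \<le> f k" for k using w0 by (simp add: f_def scaleR_nonneg_nonneg)
  have u0: "0 \<le> u" using le_suminf_lattice[OF sum_f f0, of 0] f0[of 0] by (simp add: u_def)
  have w_le: "w k \<le> (1/2)^k *\<^sub>R u" for k
  proof -
    have "(1/2)^k *\<^sub>R f k \<le> (1/2)^k *\<^sub>R u"
      unfolding u_def by (intro scaleR_left_mono le_suminf_lattice sum_f f0) simp
    then show ?thesis by (simp add: f_def flip: power_mult_distrib)
  qed
  have dominated: "\<bar>basis_proj e A x - x\<bar> \<le> (1/2)^k *\<^sub>R u"
    if A: "greedy_set e x A" "card (L k) \<le> card A" for A k
  proof -
    have finA: "finite A" using A(1) by (rule greedy_set_finite)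
    \<comment> \<open>By comparability the alternative is that \<open>A\<close> lies inside
      \<open>L k\<close>, and then the cardinalities force equality.\<close>
    have LA: "L k \<subseteq> A"
      using greedy_set_level_set_cases[OF A(1), of "t k"] A(2) card_seteq[of "L k" A] finL
      unfolding L_def by blast
    show ?thesis
    proof (cases "\<forall>i. L i \<subseteq> A")
      case True
      \<comment> \<open>The thresholds tend to 0, so the level sets cover the support and the
        projection is \<open>x\<close> itself.\<close>
      have "basis_supp e x \<subseteq> A"
      proof
        fix n assume "n \<in> basis_supp e x"
        then have "0 < \<bar>coeff_fun e n x\<bar>" by (simp add: basis_supp_def)
        then obtain i where "inverse (real (Suc i)) < \<bar>coeff_fun e n x\<bar>" using reals_Archimedean by blast
        then have "n \<in> L i" using t(2)[of i] by (simp add: L_def level_set_def inverse_eq_divide)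
        then show "n \<in> A" using True by blast
      qed
      then show ?thesis using proj_eq_self[OF x finA] u0 by (simp add: scaleR_nonneg_nonneg)
    next
      case False
      \<comment> \<open>The least level not contained in \<open>A\<close> contains \<open>A\<close>
        by comparability, and its predecessor lies in \<open>A\<close>. Since \<open>L k\<close>
        lies in \<open>A\<close>, that predecessor has index at least \<open>k\<close>.\<close>
      define i where "i = (LEAST i. \<not> L i \<subseteq> A)"
      have i: "\<not> L i \<subseteq> A" unfolding i_def using False by (metis LeastI)
      have i_min: "L j \<subseteq> A" if "j < i" for j using that not_less_Least unfolding i_def by blast
      have mono: "L a \<subseteq> L b" if "a \<le> b" for a b
        using lift_Suc_mono_le[of L, OF Lsub that] .
      have "k < i" using i LA mono[of i k] by (meson not_le order_trans)
      then obtain j where j: "i = Suc j" "k \<le> j" by (cases i) auto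
      have "A \<subseteq> L (Suc j)"
        using greedy_set_level_set_cases[OF A(1), of "t i"] i unfolding L_def j(1) by blast
      then have "\<bar>basis_proj e A x - x\<bar> \<le> w j"
        using greedy_proj_between_levels[OF x A(1) finL[of j] _ finL[of "Suc j"]] i_min[of j] j(1)
        unfolding w_def v_def TL by blast
      also have "\<dots> \<le> (1/2)^j *\<^sub>R u" by (rule w_le)
      also have "\<dots> \<le> (1/2)^k *\<^sub>R u"
        using j(2) u0 by (intro scaleR_right_mono power_decreasing) auto
      finally show ?thesis .
    qed
  qed
  have "\<exists>j0. \<forall>j\<ge>j0. \<bar>greedy_seq e x j - x\<bar> \<le> \<epsilon> *\<^sub>R u" if \<epsilon>: "0 < \<epsilon>" for \<epsilon>
  proof -
    obtain k where k: "(1/2::real)^k < \<epsilon>" using real_arch_pow_inv[OF \<epsilon>, of "1/2"] by auto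
    \<comment> \<open>Blocks are numbered from 1, so 1 is added in case \<open>L k\<close> is
      empty.\<close>
    obtain j0 where j0: "\<And>j. j \<ge> j0 \<Longrightarrow> \<exists>m\<ge>card (L k) + 1. greedy_seq e x j \<in> greedy_sums e m x"
      using greedy_seq_tail[OF x, of "card (L k) + 1"] by auto
    have "\<bar>greedy_seq e x j - x\<bar> \<le> \<epsilon> *\<^sub>R u" if "j \<ge> j0" for j
    proof -
      from j0[OF that] obtain A
        where "greedy_set e x A" "card (L k) \<le> card A" "greedy_seq e x j = basis_proj e A x"
        unfolding greedy_sums_eq[OF x] by force
      then have "\<bar>greedy_seq e x j - x\<bar> \<le> (1/2)^k *\<^sub>R u" using dominated by simp
      also have "\<dots> \<le> \<epsilon> *\<^sub>R u" using k u0 by (intro scaleR_right_mono) auto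
      finally show ?thesis .
    qed
    then show ?thesis by blast
  qed
  then show ?thesis unfolding uniform_conv_def by blast
qed

section \<open>From pointwise boundedness to the maximal inequality\<close>

text \<open>Dropping the first \<open>N\<close> coordinates costs at most a fixed multiple of
  \<open>norm x\<close> in the maximal function and enlarges the norm by at most a fixed factor,
  because the coefficients are uniformly bounded. A failure with a large enough constant survives
  this.\<close>

lemma maximal_inequality_fails_on_tails:
  assumes fails: "\<And>C. 1 \<le> C \<Longrightarrow> \<not> maximal_inequality C"
  shows "\<exists>m\<ge>1. \<exists>y\<in>E. finite (basis_supp e y) \<and> basis_supp e y \<inter> {..<N} = {} \<and>
    D * norm y < norm (greedy_max_all e m y)"
proof -
  obtain K where K: "0 < K" "\<And>x n. x \<in> E \<Longrightarrow> \<bar>coeff_fun e n x\<bar> \<le> K * norm x"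
    using coeff_bounded by blast
  obtain b where b: "0 < b" "\<And>n. norm (e n) \<le> b" using norm_e_bounds by blast
  define D' where "D' = max D 0"
  define P where "P = real N * (K * b)"
  have P0: "0 \<le> P" using K b by (simp add: P_def)
  have D0: "0 \<le> D'" "D \<le> D'" by (auto simp: D'_def)
  \<comment> \<open>\<open>P\<close> pays for the removed coordinates, \<open>D' * (1 + P)\<close>
    converts \<open>norm x\<close> into \<open>norm y\<close>, and 1 ensures
    \<open>1 \<le> C\<close>.\<close>
  define C where "C = P + D' * (1 + P) + 1"
  have "1 \<le> C" using P0 D0 by (simp add: C_def)
  then obtain m x where m: "1 \<le> m" and x: "x \<in> E" "finite (basis_supp e x)"
    and big: "C * norm x < norm (greedy_max_all e m x)"
    using fails unfolding maximal_inequality_def by (meson not_le)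
  define y where "y = x - basis_proj e {..<N} x"
  have y: "y \<in> E" unfolding y_def using x(1) subspace_diff[OF subspace_E] by simp
  have cy: "coeff_fun e n y = (if n < N then 0 else coeff_fun e n x)" for n
    using x(1) by (simp add: y_def coeff_diff coeff_proj)
  \<comment> \<open>This dominates the projections onto all sets of indices below \<open>N\<close>
    at once, whichever of them a greedy set contains.\<close>
  define w where "w = (\<Sum>n<N. \<bar>coeff_fun e n x *\<^sub>R e n\<bar>)"
  have bound: "norm (coeff_fun e n x *\<^sub>R e n) \<le> K * b * norm x" for n
  proof -
    have "norm (coeff_fun e n x *\<^sub>R e n) \<le> (K * norm x) * b"
      unfolding norm_scaleR real_norm_def using K b x(1) by (intro mult_mono) auto
    then show ?thesis by (simp add: mult_ac)
  qed
  have w: "norm w \<le> P * norm x"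
    using sum_norm_bound[of "{..<N}" "\<lambda>n. \<bar>coeff_fun e n x *\<^sub>R e n\<bar>" "K * b * norm x"] bound
    by (simp add: w_def P_def norm_abs_lattice mult.assoc)
  have "norm (basis_proj e {..<N} x) \<le> P * norm x"
    using sum_norm_bound[of "{..<N}" "\<lambda>n. coeff_fun e n x *\<^sub>R e n" "K * b * norm x"] bound
    by (simp add: basis_proj_def P_def mult.assoc)
  then have ny: "norm y \<le> (1 + P) * norm x"
    using norm_triangle_ineq4[of x "basis_proj e {..<N} x"] by (simp add: y_def algebra_simps)
  have "\<bar>basis_proj e A x\<bar> \<le> w + greedy_max_all e m y" if A: "greedy_set e x A" "card A \<le> m" for A
  proof -
    have fin: "finite A" using A(1) by (rule greedy_set_finite)
    have "basis_proj e A x = basis_proj e (A \<inter> {..<N}) x + basis_proj e (A - {..<N}) x"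
      using proj_Un[of "A \<inter> {..<N}" "A - {..<N}" x] fin
      by (metis Diff_disjoint Int_Diff_Un finite_Diff finite_Int inf_assoc inf_bot_right)
    moreover have "basis_proj e (A - {..<N}) x = basis_proj e (A - {..<N}) y"
      by (intro proj_cong_coeff) (auto simp: cy)
    moreover have "\<bar>basis_proj e (A \<inter> {..<N}) x\<bar> \<le> w"
    proof -
      have "\<bar>basis_proj e (A \<inter> {..<N}) x\<bar> \<le> (\<Sum>n\<in>A \<inter> {..<N}. \<bar>coeff_fun e n x *\<^sub>R e n\<bar>)"
        unfolding basis_proj_def by (rule sum_abs)
      also have "\<dots> \<le> w" unfolding w_def by (rule sum_mono2) auto
      finally show ?thesis .
    qed
    moreover have "\<bar>basis_proj e (A - {..<N}) y\<bar> \<le> greedy_max_all e m y"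
    proof (rule greedy_proj_le[OF y m])
      show "greedy_set e y (A - {..<N})"
        using A(1) unfolding greedy_set_def by (auto simp: cy)
      show "card (A - {..<N}) \<le> m" using card_mono[OF fin, of "A - {..<N}"] A(2) by auto
    qed
    ultimately show ?thesis by (simp add: abs_add_le_add)
  qed
  then have "greedy_max_all e m x \<le> w + greedy_max_all e m y"
    using greedy_max_all_le_iff[OF x(1) m] by blast
  then have "norm (greedy_max_all e m x) \<le> norm (w + greedy_max_all e m y)"
    by (rule norm_greedy_max_all_le[OF x(1) m])
  also have "\<dots> \<le> P * norm x + norm (greedy_max_all e m y)"
    using norm_triangle_ineq[of w "greedy_max_all e m y"] w by linarith
  finally have "(D' * (1 + P) + 1) * norm x < norm (greedy_max_all e m y)"
    using big by (simp add: C_def algebra_simps)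
  moreover have "D * norm y \<le> D' * ((1 + P) * norm x)"
    using D0 ny by (intro mult_mono) auto
  then have "D * norm y \<le> (D' * (1 + P) + 1) * norm x"
    using norm_ge_zero[of x] unfolding distrib_right mult_1 mult.assoc by linarith
  ultimately have "D * norm y < norm (greedy_max_all e m y)" by linarith
  moreover have "finite (basis_supp e y)"
    using x(2) by (rule finite_subset[rotated]) (auto simp: basis_supp_def cy)
  moreover have "basis_supp e y \<inter> {..<N} = {}" by (auto simp: basis_supp_def cy)
  ultimately show ?thesis using m y by blast
qed

section \<open>The gliding hump\<close>

text \<open>The coefficient bound keeps the support of \<open>s\<close> greedy in
  \<open>s + y\<close>, with ties allowed. The summand \<open>norm s\<close> pays for subtracting
  \<open>s\<close> from a greedy sum of the total.\<close>

definition hump :: "nat \<Rightarrow> 'a \<Rightarrow> 'a \<Rightarrow> bool" where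
  "hump k s y \<longleftrightarrow> y \<in> E \<and> finite (basis_supp e y) \<and> norm y \<le> (1/2)^k \<and>
     basis_supp e y \<inter> basis_supp e s = {} \<and>
     (\<forall>n\<in>basis_supp e s. \<forall>j. \<bar>coeff_fun e j y\<bar> \<le> \<bar>coeff_fun e n s\<bar>) \<and>
     (\<exists>m\<ge>1. real k + norm s < norm (greedy_max_all e m y))"

lemma hump_exists:
  assumes fails: "\<And>C. 1 \<le> C \<Longrightarrow> \<not> maximal_inequality C"
    and s: "finite (basis_supp e s)"
  shows "\<exists>y. hump k s y"
proof -
  obtain K where K: "0 < K" "\<And>x n. x \<in> E \<Longrightarrow> \<bar>coeff_fun e n x\<bar> \<le> K * norm x"
    using coeff_bounded by blast
  obtain N where N: "basis_supp e s \<subseteq> {..<N}" using s finite_nat_iff_bounded by blast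
  define d where "d = Min (insert 1 ((\<lambda>n. \<bar>coeff_fun e n s\<bar>) ` basis_supp e s))"
  have d0: "0 < d" using s by (auto simp: d_def basis_supp_def)
  have d: "d \<le> \<bar>coeff_fun e n s\<bar>" if "n \<in> basis_supp e s" for n
    using s that by (simp add: d_def)
  \<comment> \<open>A vector of norm \<open>r\<close> has norm at most 2^-k and, by the bound
    \<open>K\<close> on the functionals, coefficients of modulus at most \<open>d\<close>.\<close>
  define r where "r = min ((1/2)^k) (d / K)"
  have r: "0 < r" "r \<le> (1/2)^k" "K * r \<le> d" using d0 K(1) by (auto simp: r_def min_def field_simps)
  \<comment> \<open>The factor is divided by \<open>r\<close> so that rescaling \<open>z\<close> to
    norm \<open>r\<close> leaves the lower bound \<open>real k + norm s\<close>.\<close>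
  obtain m z where m: "1 \<le> m" and z: "z \<in> E" "finite (basis_supp e z)" "basis_supp e z \<inter> {..<N} = {}"
    and big: "(real k + norm s) / r * norm z < norm (greedy_max_all e m z)"
    using maximal_inequality_fails_on_tails[OF fails, of N "(real k + norm s) / r"] by blast
  have "z \<noteq> 0"
  proof
    assume "z = 0"
    then have "greedy_max_all e m z \<le> 0"
      using greedy_max_all_le_iff[OF z(1) m, of 0] by (simp add: basis_proj_def)
    then have "norm (greedy_max_all e m z) \<le> norm (0 :: 'a)"
      by (rule norm_greedy_max_all_le[OF z(1) m])
    then show False using big \<open>z = 0\<close> by simp
  qed
  define c where "c = r / norm z"
  have c: "0 < c" using r(1) \<open>z \<noteq> 0\<close> by (simp add: c_def)
  define y where "y = c *\<^sub>R z"
  have ny: "norm y = r" using \<open>z \<noteq> 0\<close> r(1) by (simp add: y_def c_def)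
  have y: "y \<in> E" unfolding y_def using z(1) subspace_scale[OF subspace_E] by blast
  have supp: "basis_supp e y = basis_supp e z"
    using z(1) c by (auto simp: basis_supp_def y_def coeff_scaleR)
  have "real k + norm s = c * ((real k + norm s) / r * norm z)"
    using r(1) \<open>z \<noteq> 0\<close> by (simp add: c_def)
  also have "\<dots> < c * norm (greedy_max_all e m z)" using big c by (rule mult_strict_left_mono)
  also have "\<dots> \<le> norm (greedy_max_all e m y)"
    unfolding y_def by (rule greedy_max_all_scaleR[OF z(1) m c])
  finally have "real k + norm s < norm (greedy_max_all e m y)" .
  moreover have "\<bar>coeff_fun e j y\<bar> \<le> \<bar>coeff_fun e n s\<bar>" if "n \<in> basis_supp e s" for n j
    using K(2)[OF y, of j] r(3) d[OF that] unfolding ny by linarith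
  moreover have "basis_supp e y \<inter> basis_supp e s = {}" using z(3) N supp by blast
  ultimately have "hump k s y"
    using y z(2) supp m ny r(2) unfolding hump_def by auto
  then show ?thesis by blast
qed

lemma maximal_inequality_if_norm_bounded:
  assumes bdd: "\<And>x. x \<in> E \<Longrightarrow> \<exists>C>0. \<forall>m\<ge>1. norm (greedy_max_all e m x) \<le> C"
  shows "\<exists>C\<ge>1. maximal_inequality C"
proof (rule ccontr)
  assume "\<not> ?thesis"
  then have fails: "\<And>C. 1 \<le> C \<Longrightarrow> \<not> maximal_inequality C" by blast
  \<comment> \<open>The running sums are chosen rather than the blocks, since each block depends on
    all earlier ones.\<close>
  have "\<exists>s. \<forall>k. (s k \<in> E \<and> finite (basis_supp e (s k))) \<and> hump k (s k) (s (Suc k) - s k)"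
  proof (rule dependent_nat_choice)
    show "\<exists>s. s \<in> E \<and> finite (basis_supp e s)"
      using subspace_0[OF subspace_E] by (intro exI[of _ 0]) (simp add: basis_supp_def)
    fix s k assume s: "s \<in> E \<and> finite (basis_supp e s)"
    then obtain y where y: "hump k s y" using hump_exists[OF fails] by blast
    then have yE: "y \<in> E" "finite (basis_supp e y)" by (auto simp: hump_def)
    have "s + y \<in> E" using s yE subspace_add[OF subspace_E] by blast
    moreover have "basis_supp e (s + y) \<subseteq> basis_supp e s \<union> basis_supp e y"
      using s yE by (auto simp: basis_supp_def coeff_add)
    then have "finite (basis_supp e (s + y))" using s yE finite_subset finite_UnI by metis
    ultimately show "\<exists>s'. (s' \<in> E \<and> finite (basis_supp e s')) \<and> hump k s (s' - s)"
      using y by (intro exI[of _ "s + y"]) simp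
  qed
  then obtain s where s: "\<And>k. s k \<in> E" "\<And>k. finite (basis_supp e (s k))"
    and hump: "\<And>k. hump k (s k) (s (Suc k) - s k)" by blast
  define c where "c k n = coeff_fun e n (s k)" for k n
  define S where "S k = basis_supp e (s k)" for k
  define y where "y k = s (Suc k) - s k" for k
  have yE: "y k \<in> E" for k unfolding y_def using s(1) subspace_diff[OF subspace_E] by blast
  have cy: "coeff_fun e n (y k) = c (Suc k) n - c k n" for n k
    using s(1) by (simp add: y_def c_def coeff_diff)
  have S_iff: "n \<in> S k \<longleftrightarrow> c k n \<noteq> 0" for n k by (simp add: S_def c_def basis_supp_def)
  have c_Suc: "c (Suc k) n = c k n" if "n \<in> S k" for n k
  proof -
    have "n \<notin> basis_supp e (y k)"
      using hump[of k] that unfolding hump_def y_def[symmetric] S_def[symmetric] by blast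
    then show ?thesis using cy[of n k] by (simp add: basis_supp_def)
  qed
  have c_small: "\<bar>c (Suc k) j - c k j\<bar> \<le> \<bar>c k n\<bar>" if "n \<in> S k" for n j k
    using hump[of k] that unfolding hump_def y_def[symmetric] S_def[symmetric] cy c_def[symmetric]
    by blast
  \<comment> \<open>A nonzero coefficient is frozen, because the next block is always disjoint from
    the support so far.\<close>
  have c_stable: "c (k + i) n = c k n" if "n \<in> S k" for n k i
  proof (induction i)
    case (Suc i)
    then have "n \<in> S (k + i)" using that by (simp add: S_iff)
    then show ?case using c_Suc Suc by simp
  qed simp
  \<comment> \<open>The index \<open>j\<close> receives its coefficient in one step only; there
    \<open>c_small\<close> compares it with the coefficient at \<open>n\<close>, which is already
    frozen.\<close>
  have c_below: "\<bar>c (k + i) j\<bar> \<le> \<bar>c k n\<bar>" if "n \<in> S k" "j \<notin> S k" for n j k i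
  proof (induction i)
    case 0
    then show ?case using that by (simp add: S_iff)
  next
    case (Suc i)
    show ?case
    proof (cases "j \<in> S (k + i)")
      case True
      then show ?thesis using c_Suc[OF True] Suc by simp
    next
      case False
      have "n \<in> S (k + i)" using c_stable[OF that(1)] that(1) by (simp add: S_iff)
      then show ?thesis
        using c_small[of n "k + i" j] False c_stable[OF that(1)] by (simp add: S_iff)
    qed
  qed
  have "summable y"
  proof (rule summable_comparison_test')
    show "summable (\<lambda>k. (1/2::real)^k)" by (intro summable_geometric) simp
    show "norm (y k) \<le> (1/2)^k" for k using hump[of k] by (simp add: hump_def y_def)
  qed
  then have "(\<lambda>n. \<Sum>k<n. y k) \<longlonglongrightarrow> suminf y" by (rule summable_LIMSEQ)
  \<comment> \<open>The dependent choice leaves \<open>s 0\<close> unspecified, so the telescoping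
    sum carries it along.\<close>
  then have "(\<lambda>n. (\<Sum>k<n. y k) + s 0) \<longlonglongrightarrow> suminf y + s 0" by (intro tendsto_intros)
  moreover have "(\<Sum>k<n. y k) + s 0 = s n" for n by (simp add: y_def sum_lessThan_telescope)
  ultimately obtain x where lim: "s \<longlonglongrightarrow> x" by auto
  have x: "x \<in> E" using closed_E s(1) lim closed_sequentially by blast
  have c_lim: "(\<lambda>k. c k n) \<longlonglongrightarrow> coeff_fun e n x" for n
  proof -
    obtain K where K: "\<And>x n. x \<in> E \<Longrightarrow> \<bar>coeff_fun e n x\<bar> \<le> K * norm x"
      using coeff_bounded by blast
    have "(\<lambda>k. K * norm (s k - x)) \<longlonglongrightarrow> K * norm (x - x)" by (intro tendsto_intros lim)
    then have null: "(\<lambda>k. K * norm (s k - x)) \<longlonglongrightarrow> 0" by simp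
    have "norm (c k n - coeff_fun e n x) \<le> K * norm (s k - x)" for k
      using K[of "s k - x" n] s(1) x subspace_diff[OF subspace_E] by (simp add: c_def coeff_diff)
    then have "(\<lambda>k. c k n - coeff_fun e n x) \<longlonglongrightarrow> 0"
      by (intro Lim_null_comparison[OF _ null] always_eventually) blast
    then show ?thesis by (rule LIM_zero_cancel)
  qed
  have cx: "coeff_fun e n x = c k n" if "n \<in> S k" for n k
  proof (rule LIMSEQ_unique[OF LIMSEQ_ignore_initial_segment[OF c_lim]])
    show "(\<lambda>i. c (i + k) n) \<longlonglongrightarrow> c k n" using c_stable[OF that] by (simp add: add.commute)
  qed
  have cx_below: "\<bar>coeff_fun e j x\<bar> \<le> \<bar>coeff_fun e n x\<bar>" if "n \<in> S k" "j \<notin> S k" for n j k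
  proof -
    have "(\<lambda>i. \<bar>c (i + k) j\<bar>) \<longlonglongrightarrow> \<bar>coeff_fun e j x\<bar>"
      by (intro tendsto_rabs LIMSEQ_ignore_initial_segment c_lim)
    then have "\<bar>coeff_fun e j x\<bar> \<le> \<bar>c k n\<bar>"
      by (rule LIMSEQ_le_const2) (use c_below[OF that] in \<open>simp add: add.commute\<close>)
    then show ?thesis using cx[OF that(1)] by simp
  qed
  have S_Suc: "S (Suc k) = S k \<union> basis_supp e (y k)" for k
    using c_Suc by (auto simp: S_iff basis_supp_def cy)
  have S_disj: "S k \<inter> basis_supp e (y k) = {}" for k
    using c_Suc by (auto simp: basis_supp_def cy)
  have finS: "finite (S k)" for k using s(2) by (simp add: S_def)
  obtain C where C: "\<And>m. 1 \<le> m \<Longrightarrow> norm (greedy_max_all e m x) \<le> C" using bdd[OF x] by blast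
  obtain k :: nat where k: "C \<le> real k" using real_arch_simple by blast
  obtain m where m: "1 \<le> m" and big: "real k + norm (s k) < norm (greedy_max_all e m (y k))"
    using hump[of k] unfolding hump_def y_def[symmetric] by blast
  define M where "M = card (S k) + m"
  have M: "1 \<le> M" using m by (simp add: M_def)
  have "\<bar>basis_proj e A (y k)\<bar> \<le> \<bar>s k\<bar> + greedy_max_all e M x"
    if A: "greedy_set e (y k) A" "card A \<le> m" for A
  proof -
    \<comment> \<open>\<open>A\<close> may contain indices where \<open>y k\<close> vanishes,
      possibly from \<open>S k\<close> or from later blocks. Dropping them preserves the projection
      of \<open>y k\<close> and makes the set disjoint from \<open>S k\<close>.\<close>
    define B where "B = A \<inter> basis_supp e (y k)"
    have finA: "finite A" using A(1) by (rule greedy_set_finite)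
    have B: "greedy_set e (y k) B" unfolding B_def by (rule greedy_set_Int_supp[OF A(1)])
    have finB: "finite B" using B by (rule greedy_set_finite)
    have BS: "B \<subseteq> S (Suc k)" "S k \<inter> B = {}" using S_Suc[of k] S_disj[of k] by (auto simp: B_def)
    have cxy: "coeff_fun e n x = coeff_fun e n (y k)" if "n \<in> basis_supp e (y k)" for n
    proof -
      have "n \<in> S (Suc k)" "n \<notin> S k" using that S_Suc[of k] S_disj[of k] by auto
      then show ?thesis using cx[of n "Suc k"] cy[of n k] by (simp add: S_iff)
    qed
    \<comment> \<open>On \<open>S (Suc k)\<close> outside \<open>S k\<close> the coefficients of
      \<open>x\<close> are those of \<open>y k\<close>, so the greediness of \<open>B\<close>
      applies there; all other comparisons are instances of \<open>cx_below\<close>.\<close>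
    have "greedy_set e x (S k \<union> B)"
      unfolding greedy_set_def
    proof (intro conjI ballI allI impI)
      show "finite (S k \<union> B)" using finS finB by simp
      fix n j assume n: "n \<in> S k \<union> B" and j: "j \<notin> S k \<union> B"
      show "\<bar>coeff_fun e j x\<bar> \<le> \<bar>coeff_fun e n x\<bar>"
      proof (cases "n \<in> S k")
        case True
        then show ?thesis using j by (intro cx_below) auto
      next
        case False
        then have nB: "n \<in> B" using n by blast
        show ?thesis
        proof (cases "j \<in> S (Suc k)")
          case True
          then have "j \<in> basis_supp e (y k)" using S_Suc[of k] j by blast
          moreover have "n \<in> basis_supp e (y k)" using nB by (simp add: B_def)
          ultimately show ?thesis using greedy_setD[OF B nB, of j] j cxy by auto
        next
          case False
          then show ?thesis using nB BS by (intro cx_below) auto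
        qed
      qed
    qed
    moreover have "card (S k \<union> B) \<le> M"
      using card_Un_le[of "S k" B] card_mono[OF finA, of B] A(2) by (simp add: M_def B_def)
    ultimately have "\<bar>basis_proj e (S k \<union> B) x\<bar> \<le> greedy_max_all e M x"
      using greedy_proj_le[OF x M] by blast
    moreover have "basis_proj e (S k \<union> B) x = s k + basis_proj e A (y k)"
    proof -
      have "basis_proj e (S k) x = basis_proj e (S k) (s k)"
        using cx by (intro proj_cong_coeff) (simp add: c_def)
      also have "\<dots> = s k" using s finS by (intro proj_eq_self) (auto simp: S_def)
      finally have "basis_proj e (S k) x = s k" .
      moreover have "basis_proj e B x = basis_proj e B (y k)"
        using cxy by (intro proj_cong_coeff) (simp add: B_def)
      moreover have "basis_proj e B (y k) = basis_proj e A (y k)"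
        unfolding B_def using finA by (rule proj_Int_supp)
      ultimately show ?thesis using proj_Un[OF finS finB BS(2)] by simp
    qed
    ultimately have "\<bar>s k + basis_proj e A (y k)\<bar> \<le> greedy_max_all e M x" by simp
    then show ?thesis
      using abs_add_le_add[of "- s k" "\<bar>s k\<bar>" "s k + basis_proj e A (y k)"] by simp
  qed
  then have "greedy_max_all e m (y k) \<le> \<bar>s k\<bar> + greedy_max_all e M x"
    using greedy_max_all_le_iff[OF yE m] by blast
  then have "norm (greedy_max_all e m (y k)) \<le> norm (\<bar>s k\<bar> + greedy_max_all e M x)"
    by (rule norm_greedy_max_all_le[OF yE m])
  also have "\<dots> \<le> norm (s k) + C"
    using norm_triangle_ineq[of "\<bar>s k\<bar>" "greedy_max_all e M x"] C[OF M]
    by (simp add: norm_abs_lattice)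
  \<comment> \<open>The summand \<open>norm (s k)\<close> of the hump cancels, leaving
    \<open>real k < C\<close> against the choice of \<open>k\<close>.\<close>
  finally show False using big k by simp
qed

end

section \<open>The cycle of implications\<close>

theorem theorem3p11:
  fixes E :: "'a::banach_lattice set" and e :: "nat \<Rightarrow> 'a"
  assumes "subspace E" "closed E"
    and "schauder_basis e E" "semi_normalized e"
  shows "all_equivalent
    [\<forall>x\<in>E. uniform_conv (greedy_seq e x) x,
     \<forall>x\<in>E. sigma_order_conv (greedy_seq e x) x,
     \<forall>x\<in>E. order_conv (greedy_seq e x) x,
     \<forall>x\<in>E. \<exists>u. \<forall>\<pi>\<in>greedy_orderings e x. \<forall>m\<ge>1. greedy_max e \<pi> m x \<le> u,
     \<forall>x\<in>E. \<exists>C>0. \<forall>m\<ge>1. norm (greedy_max_all e m x) \<le> C,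
     \<exists>C\<ge>1. \<forall>m\<ge>1. \<forall>x\<in>E. finite (basis_supp e x) \<longrightarrow>
       norm (greedy_max_all e m x) \<le> C * norm x]"
    (is "all_equivalent [?i, ?ii, ?iii, ?iv, ?v, ?vi]")
proof -
  interpret lattice_basic_sequence e E
    using assms by unfold_locales
  have "?i \<Longrightarrow> ?ii" using uniform_conv_imp_sigma_order_conv by blast
  moreover have "?ii \<Longrightarrow> ?iii" using sigma_order_conv_imp_order_conv by blast
  moreover have "?iii \<Longrightarrow> ?iv" using order_bounded_if_order_conv by blast
  moreover have "?iv \<Longrightarrow> ?v" using norm_bounded_if_order_bounded by blast
  moreover have "?v \<Longrightarrow> ?vi"
    using maximal_inequality_if_norm_bounded unfolding maximal_inequality_def by blast
  moreover have "?i" if vi: ?vi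
  proof -
    from vi obtain C where "1 \<le> C" "maximal_inequality C"
      unfolding maximal_inequality_def by blast
    then show ?i using uniform_conv_if_maximal_inequality[of C] by simp
  qed
  ultimately show ?thesis unfolding all_equivalent_def by (simp only: list.set ball_simps) argo
qed

end
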